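(* Let $R$ be a valuation domain of cardinality $\aleph_1$ and $J/R$ an essentially countable type with $J$ not countably generated. Then there is an explicitly non-standard uniserial $R$-module of type $J/R$.
   Context: A valuation domain is an integral domain whose ideals are linearly ordered; $Q$ is its quotient field. A module is uniserial if its submodules are linearly ordered. A uniserial $R$-module is standard if isomorphic to $J'/A$ for $R$-submodules $A\subseteq J'$ of $Q$, non-standard otherwise. For a uniserial $U$ and $0\neq a\in U$, $\mathrm{Ann}(a)=\{r\in R:ra=0\}$, $D(a)=\bigcup\{r^{-1}R: a\in rU\}$; $U$ has type $J/A$ if $J/A\cong D(a)/\mathrm{Ann}(a)$. A type $J/R$: $R\subseteq J\subseteq Q$, $J$ an $R$-submodule, written $J=\bigcup_{\sigma<\omega_1} r_\sigma^{-1}R$ with nonzero $r_\sigma\in R$, $r_\tau\mid r_\sigma$ and $r_\sigma\nmid r_\tau$ for $\tau<\sigma$. The type is essentially countable if there is $\gamma<\omega_1$ with $r_\gamma R/r_\sigma R$ countable for all $\gamma<\sigma<\omega_1$ (independent of the choice of the $r_\sigma$). For $U$ of type $J/R$, fix $a_\sigma\in U$ with $\mathrm{Ann}(a_\sigma)=r_\sigma R$ and let $I_\sigma$ be the set of $R$-module isomorphisms $a_\sigma R\to r_\sigma^{-1}R/R$. A special family of functions for $U$ is a family of maps $f_\sigma:I_\sigma\to\mathbb{Q}$ ($\sigma<\omega_1$) such that $f_\sigma(\psi)<f_\rho(\varphi)$ whenever $\sigma<\rho$, $\psi\in I_\sigma$, $\varphi\in I_\rho$ and $\varphi$ extends $\psi$.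 $U$ is explicitly non-standard if it has a special family of functions. *)

theory Defs
  imports "HOL-Library.Countable_Set" "HOL-Algebra.Module" "HOL-Computational_Algebra.Fraction_Field"
begin

definition is_ideal :: "'a::idom set \<Rightarrow> bool" where
  "is_ideal I \<longleftrightarrow> 0 \<in> I \<and> (\<forall>x\<in>I. \<forall>y\<in>I. x + y \<in> I) \<and> (\<forall>r. \<forall>x\<in>I. r * x \<in> I)"

definition valuation_domain :: "'a::idom itself \<Rightarrow> bool" where
  "valuation_domain _ \<longleftrightarrow>
     (\<forall>I J :: 'a set. is_ideal I \<and> is_ideal J \<longrightarrow> I \<subseteq> J \<or> J \<subseteq> I)"

definition RR :: "'a::idom ring" where
  "RR = \<lparr>carrier = UNIV, mult = times, one = 1, zero = 0, add = (+)\<rparr>"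

definition Rq :: "'a::idom fract set" where
  "Rq = range (\<lambda>r. Fract r 1)"

definition invR :: "'a::idom \<Rightarrow> 'a fract set" where
  "invR r = {Fract x r | x. True}"

definition pideal :: "'a::idom \<Rightarrow> 'a set" where
  "pideal r = {r * x | x. True}"

definition embR :: "'a::idom set \<Rightarrow> 'a fract set" where
  "embR A = (\<lambda>r. Fract r 1) ` A"

definition Rsubmod_Q :: "'a::idom fract set \<Rightarrow> bool" where
  "Rsubmod_Q J \<longleftrightarrow> 0 \<in> J \<and> (\<forall>x\<in>J. \<forall>y\<in>J. x + y \<in> J) \<and> (\<forall>r. \<forall>x\<in>J. Fract r 1 * x \<in> J)"

definition Rspan_Q :: "'a::idom fract set \<Rightarrow> 'a fract set" where
  "Rspan_Q C = {(\<Sum>x\<in>F. Fract (c x) 1 * x) | F c. finite F \<and> F \<subseteq> C}"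

definition countably_generated :: "'a::idom fract set \<Rightarrow> bool" where
  "countably_generated J \<longleftrightarrow> (\<exists>C. countable C \<and> C \<subseteq> J \<and> J = Rspan_Q C)"

(* R-module isomorphism  J/A \<cong> J'/A'  of quotients of R-submodules A \<subseteq> J, A' \<subseteq> J' of Q,
  given through a lift g: J \<rightarrow> J' of the isomorphism to representatives. *)
definition quot_iso :: "'a::idom fract set \<Rightarrow> 'a fract set \<Rightarrow> 'a fract set \<Rightarrow> 'a fract set \<Rightarrow> bool" where
  "quot_iso J A J' A' \<longleftrightarrow> (\<exists>g.
      (\<forall>x\<in>J. g x \<in> J') \<and>
      (\<forall>x\<in>J. \<forall>y\<in>J. g (x + y) - g x - g y \<in> A') \<and>
      (\<forall>r. \<forall>x\<in>J. g (Fract r 1 * x) - Fract r 1 * g x \<in> A') \<and>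
      (\<forall>x\<in>J. g x \<in> A' \<longleftrightarrow> x \<in> A) \<and>
      (\<forall>y\<in>J'. \<exists>x\<in>J. y - g x \<in> A'))"

definition omega1_order :: "('i \<times> 'i) set \<Rightarrow> bool" where
  "omega1_order W \<longleftrightarrow> Well_order W \<and> ordIso2 W (cardSuc natLeq)"

definition type_repr :: "('i \<times> 'i) set \<Rightarrow> ('i \<Rightarrow> 'a::idom) \<Rightarrow> 'a fract set \<Rightarrow> bool" where
  "type_repr W r J \<longleftrightarrow> omega1_order W \<and>
     (\<forall>\<sigma>\<in>Field W. r \<sigma> \<noteq> 0) \<and>
     (\<forall>\<tau> \<sigma>. (\<tau>, \<sigma>) \<in> W \<and> \<tau> \<noteq> \<sigma> \<longrightarrow> r \<tau> dvd r \<sigma> \<and> \<not> r \<sigma> dvd r \<tau>) \<and>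
     J = (\<Union>\<sigma>\<in>Field W. invR (r \<sigma>))"

definition countable_quot :: "'a::idom set \<Rightarrow> 'a set \<Rightarrow> bool" where
  "countable_quot I K \<longleftrightarrow> countable ((\<lambda>x. (\<lambda>k. x + k) ` K) ` I)"

definition essentially_countable :: "'a::idom fract set \<Rightarrow> bool" where
  "essentially_countable J \<longleftrightarrow>
     (\<exists>(W :: ('a \<times> 'a) set) r. type_repr W r J \<and>
        (\<exists>\<gamma>\<in>Field W. \<forall>\<sigma>\<in>Field W. (\<gamma>, \<sigma>) \<in> W \<and> \<gamma> \<noteq> \<sigma> \<longrightarrow>
            countable_quot (pideal (r \<gamma>)) (pideal (r \<sigma>))))"

definition uniserial :: "('a::idom, 'm) module \<Rightarrow> bool" where
  "uniserial M \<longleftrightarrow> module RR M \<and>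
     (\<forall>N1 N2. submodule N1 RR M \<and> submodule N2 RR M \<longrightarrow> N1 \<subseteq> N2 \<or> N2 \<subseteq> N1)"

definition Ann :: "('a::idom, 'm) module \<Rightarrow> 'm \<Rightarrow> 'a set" where
  "Ann M a = {r. r \<odot>\<^bsub>M\<^esub> a = \<zero>\<^bsub>M\<^esub>}"

definition Dv :: "('a::idom, 'm) module \<Rightarrow> 'm \<Rightarrow> 'a fract set" where
  "Dv M a = (\<Union>{invR r | r. r \<noteq> 0 \<and> a \<in> (\<lambda>u. r \<odot>\<^bsub>M\<^esub> u) ` carrier M})"

definition has_type :: "('a::idom, 'm) module \<Rightarrow> 'a fract set \<Rightarrow> 'a fract set \<Rightarrow> bool" where
  "has_type M J A \<longleftrightarrow>
     (\<exists>a\<in>carrier M. a \<noteq> \<zero>\<^bsub>M\<^esub> \<and> quot_iso (Dv M a) (embR (Ann M a)) J A)"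

definition cyc :: "('a::idom, 'm) module \<Rightarrow> 'm \<Rightarrow> 'm set" where
  "cyc M a = (\<lambda>r. r \<odot>\<^bsub>M\<^esub> a) ` UNIV"

(* Elements of r^{-1}R/R are represented by the cosets x + R (as subsets of Q);
  sum and scalar multiple of cosets. *)
definition coset_R :: "'a::idom fract \<Rightarrow> 'a fract set" where
  "coset_R x = (\<lambda>y. x + y) ` Rq"

definition cset_add :: "'a::idom fract set \<Rightarrow> 'a fract set \<Rightarrow> 'a fract set" where
  "cset_add X Y = {x + y | x y. x \<in> X \<and> y \<in> Y}"

definition cset_smult :: "'a::idom \<Rightarrow> 'a fract set \<Rightarrow> 'a fract set" where
  "cset_smult r X = {Fract r 1 * x + y | x y. x \<in> X \<and> y \<in> Rq}"

definition Isos :: "('a::idom, 'm) module \<Rightarrow> 'm \<Rightarrow> 'a \<Rightarrow> ('m \<Rightarrow> 'a fract set) set" where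
  "Isos M a r = {\<psi>. \<psi> \<in> extensional (cyc M a) \<and>
      bij_betw \<psi> (cyc M a) (coset_R ` invR r) \<and>
      (\<forall>u\<in>cyc M a. \<forall>v\<in>cyc M a. \<psi> (u \<oplus>\<^bsub>M\<^esub> v) = cset_add (\<psi> u) (\<psi> v)) \<and>
      (\<forall>s. \<forall>u\<in>cyc M a. \<psi> (s \<odot>\<^bsub>M\<^esub> u) = cset_smult s (\<psi> u))}"

definition explicitly_nonstandard :: "('a::idom, 'm) module \<Rightarrow> 'a fract set \<Rightarrow> bool" where
  "explicitly_nonstandard M J \<longleftrightarrow>
     (\<exists>(W :: ('a \<times> 'a) set) r a (f :: 'a \<Rightarrow> ('m \<Rightarrow> 'a fract set) \<Rightarrow> rat).
        type_repr W r J \<and>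
        (\<forall>\<sigma>\<in>Field W. a \<sigma> \<in> carrier M \<and> Ann M (a \<sigma>) = pideal (r \<sigma>)) \<and>
        (\<forall>\<sigma> \<rho> \<psi> \<phi>. (\<sigma>, \<rho>) \<in> W \<and> \<sigma> \<noteq> \<rho> \<and>
            \<psi> \<in> Isos M (a \<sigma>) (r \<sigma>) \<and> \<phi> \<in> Isos M (a \<rho>) (r \<rho>) \<and>
            (\<forall>u\<in>cyc M (a \<sigma>). \<phi> u = \<psi> u) \<longrightarrow> f \<sigma> \<psi> < f \<rho> \<phi>))"

end

theory Submission
  imports Defs "HOL-Library.Countable_Set_Type"
begin

text \<open>
  A module of type \<open>J/R\<close> is the direct limit of the modules \<open>r\<^sub>\<sigma>\<^sup>-\<^sup>1R/R\<close> along maps \<open>x \<mapsto> e\<^sub>\<rho>\<^sub>\<sigma> x\<close>,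
  where the units \<open>e\<^sub>\<rho>\<^sub>\<sigma>\<close> satisfy the cocycle condition \<open>e\<^sub>\<rho>\<^sub>\<sigma> \<equiv> e\<^sub>\<rho>\<^sub>\<tau> e\<^sub>\<tau>\<^sub>\<sigma>\<close> modulo \<open>r\<^sub>\<sigma>\<close>. The isomorphisms in
  \<open>I\<^sub>\<sigma>\<close> correspond to the units modulo \<open>r\<^sub>\<sigma>\<close>, and a special family consists of functions \<open>f\<^sub>\<sigma>\<close> on these
  with \<open>f\<^sub>\<sigma> (x e\<^sub>\<rho>\<^sub>\<sigma>) < f\<^sub>\<rho> x\<close>. Restricted to the units congruent to 1 modulo \<open>r\<^sub>\<gamma>\<close>, every level is countable, and
  \<open>e\<close> and \<open>f\<close> are built together by transfinite recursion, as for a special Aronszajn tree. The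
  recursion carries a finite extension property: finitely many bounds \<open>f\<^sub>\<sigma> (y x) < q\<close> can be preserved when
  \<open>x\<close> is lifted to a later level. To have room for this, the \<open>r\<^sub>\<sigma>\<close> are first thinned out so that
  consecutive kernels are infinite. At level \<open>\<kappa>\<close> a branch through a cofinal
  sequence of earlier levels is chosen step by step, together with a growing finite part of \<open>f\<^sub>\<kappa>\<close>.
\<close>

unbundle cardinal_syntax

section \<open>Well-orders of type \<open>\<omega>\<^sub>1\<close>\<close>

text \<open>\<open>W\<close> is a cardinal order isomorphic to the successor of
  \<open>natLeq\<close>, so each proper initial segment has smaller cardinality, hence is countable.
  This lets every level be handled by a construction of length omega.\<close>

lemma omega1_countable_underS:
  assumes "omega1_order W"
  shows "countable (underS W a)"
proof (cases "a \<in> Field W")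
  case True
  have W: "W =o cardSuc natLeq"
    using assms by (simp add: omega1_order_def)
  have "Card_order W"
    using Card_order_ordIso[OF _ W] cardSuc_Card_order natLeq_Card_order by blast
  then have "|underS W a| <o W"
    using True by (rule card_of_underS)
  then have "|underS W a| <o cardSuc natLeq"
    using W ordLess_ordIso_trans by blast
  then have "|underS W a| \<le>o natLeq"
    using cardSuc_ordLeq_ordLess[OF natLeq_Card_order card_of_Card_order] by blast
  then show ?thesis
    by (simp add: countable_card_le_natLeq)
next
  case False
  then have "underS W a = {}"
    by (auto simp: underS_def Field_def)
  then show ?thesis by simp
qed

text \<open>Regularity of omega_1: without a strict bound, totality would cover the field by the
  sets \<open>insert a (underS W a)\<close>, and the uncountable field would be a countable union of
  countable sets.\<close>

lemma omega1_bounded: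
  assumes W: "omega1_order W" and A: "countable A" "A \<subseteq> Field W"
  shows "\<exists>\<mu>\<in>Field W. \<forall>a\<in>A. (a, \<mu>) \<in> W \<and> a \<noteq> \<mu>"
proof -
  have wo: "Well_order W" and iso: "W =o cardSuc natLeq"
    using W by (auto simp: omega1_order_def)
  show ?thesis
  proof (rule ccontr)
    assume contr: "\<not> ?thesis"
    have "Field W \<subseteq> (\<Union>a\<in>A. insert a (underS W a))"
    proof
      fix \<mu> assume \<mu>: "\<mu> \<in> Field W"
      then obtain a where a: "a \<in> A" "\<not> ((a, \<mu>) \<in> W \<and> a \<noteq> \<mu>)"
        using contr by blast
      then have "a = \<mu> \<or> (\<mu>, a) \<in> W"
        using wo \<mu> A(2) unfolding order_on_defs total_on_def by blast
      then show "\<mu> \<in> (\<Union>a\<in>A. insert a (underS W a))"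
        using a(1) by (auto simp: underS_def)
    qed
    moreover have "countable (\<Union>a\<in>A. insert a (underS W a))"
      using A(1) omega1_countable_underS[OF W] by simp
    ultimately have "countable (Field W)"
      using countable_subset by blast
    then have le: "|Field W| \<le>o natLeq"
      by (simp add: countable_card_le_natLeq)
    have "Card_order W"
      using Card_order_ordIso[OF _ iso] cardSuc_Card_order natLeq_Card_order by blast
    then have "|Field W| =o cardSuc natLeq"
      using card_of_Field_ordIso iso ordIso_transitive by blast
    then have "cardSuc natLeq \<le>o natLeq"
      using le ordIso_ordLeq_trans ordIso_symmetric by blast
    then show False
      using cardSuc_greater[OF natLeq_Card_order] not_ordLess_ordLeq by blast
  qed
qed

text \<open>Such a chain later yields infinitely many units \<open>1 + r (k n)\<close> that are
  congruent to 1 at the lower index and pairwise incongruent at the upper one.\<close>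

definition infinite_gap :: "'i rel \<Rightarrow> 'i \<Rightarrow> 'i \<Rightarrow> bool" where
  "infinite_gap W \<sigma> \<rho> \<longleftrightarrow> (\<exists>k :: nat \<Rightarrow> 'i. (\<forall>n. (\<sigma>, k n) \<in> W \<and> (k n, \<rho>) \<in> W) \<and>
     (\<forall>m n. m < n \<longrightarrow> (k m, k n) \<in> W \<and> k m \<noteq> k n))"

text \<open>Iterated bounding gives a strictly increasing sequence above all of \<open>A\<close>;
  one more bound, placed above that sequence, is the required index.\<close>

lemma infinite_gap_above:
  assumes W: "omega1_order W" and A: "countable A" "A \<subseteq> Field W"
  shows "\<exists>\<mu>\<in>Field W. \<forall>a\<in>A. infinite_gap W a \<mu> \<and> (a, \<mu>) \<in> W \<and> a \<noteq> \<mu>"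
proof -
  have wo: "Well_order W" using W by (simp add: omega1_order_def)
  have trans: "(x, z) \<in> W" if "(x, y) \<in> W" "(y, z) \<in> W" for x y z
    using wo that unfolding order_on_defs trans_def by blast
  have antisym: "x = y" if "(x, y) \<in> W" "(y, x) \<in> W" for x y
    using wo that unfolding order_on_defs antisym_def by blast
  have "\<exists>k. \<forall>n::nat. (k n \<in> Field W \<and> (\<forall>a\<in>A. (a, k n) \<in> W \<and> a \<noteq> k n)) \<and> ((k n, k (Suc n)) \<in> W \<and> k n \<noteq> k (Suc n))"
  proof (rule dependent_nat_choice)
    show "\<exists>x. x \<in> Field W \<and> (\<forall>a\<in>A. (a, x) \<in> W \<and> a \<noteq> x)"
      using omega1_bounded[OF W A] by blast
    show "\<exists>y. (y \<in> Field W \<and> (\<forall>a\<in>A. (a, y) \<in> W \<and> a \<noteq> y)) \<and> (x, y) \<in> W \<and> x \<noteq> y"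
      if x: "x \<in> Field W \<and> (\<forall>a\<in>A. (a, x) \<in> W \<and> a \<noteq> x)" for x
    proof -
      have "countable (insert x A)" "insert x A \<subseteq> Field W"
        using A x by auto
      from omega1_bounded[OF W this] show ?thesis
        by blast
    qed
  qed
  then obtain k :: "nat \<Rightarrow> 'a" where k: "\<And>n. k n \<in> Field W" "\<And>n a. a \<in> A \<Longrightarrow> (a, k n) \<in> W \<and> a \<noteq> k n"
    "\<And>n. (k n, k (Suc n)) \<in> W \<and> k n \<noteq> k (Suc n)"
    by blast
  have k_less: "(k m, k n) \<in> W \<and> k m \<noteq> k n" if "m < n" for m n
    using that
  proof (induction n)
    case 0
    then show ?case by simp
  next
    case (Suc n)
    then show ?case
      using k(3)[of n] trans antisym less_Suc_eq by metis
  qed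
  obtain \<mu> where \<mu>: "\<mu> \<in> Field W" "\<And>n. (k n, \<mu>) \<in> W \<and> k n \<noteq> \<mu>"
    using omega1_bounded[OF W, of "range k"] k(1) by auto
  show ?thesis
  proof (intro bexI[OF _ \<mu>(1)] ballI conjI)
    show "(a, \<mu>) \<in> W" "a \<noteq> \<mu>" if "a \<in> A" for a
      using k(2)[OF that, of 0] \<mu>(2)[of 0] trans antisym by metis+
    show "infinite_gap W a \<mu>" if "a \<in> A" for a
      unfolding infinite_gap_def using k(2)[OF that] \<mu>(2) k_less by (intro exI[of _ k]) blast
  qed
qed

text \<open>Staying above \<sigma> keeps the values cofinal, so the union that defines
  \<open>J\<close> does not change. Staying strictly beyond \<gamma> makes the countability
  hypothesis available at every new level and every new \<open>r (s \<sigma>)\<close> a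
  nonunit.\<close>

lemma infinite_gap_reindexing:
  assumes W: "omega1_order W" and \<gamma>: "\<gamma> \<in> Field W"
  obtains s where "\<And>\<sigma>. \<sigma> \<in> Field W \<Longrightarrow> s \<sigma> \<in> Field W \<and> (\<sigma>, s \<sigma>) \<in> W \<and> (\<gamma>, s \<sigma>) \<in> W \<and> \<gamma> \<noteq> s \<sigma>"
    and "\<And>\<sigma> \<rho>. (\<sigma>, \<rho>) \<in> W \<Longrightarrow> \<sigma> \<noteq> \<rho> \<Longrightarrow> infinite_gap W (s \<sigma>) (s \<rho>) \<and> (s \<sigma>, s \<rho>) \<in> W \<and> s \<sigma> \<noteq> s \<rho>"
proof -
  \<comment> \<open>The clause for \<rho> consults \<open>s\<close> only strictly below \<rho>, as
    the well-founded choice principle demands; outside the field nothing is required.\<close>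
  define good where "good s \<rho> \<mu> \<longleftrightarrow> (\<rho> \<in> Field W \<longrightarrow> \<mu> \<in> Field W \<and> (\<rho>, \<mu>) \<in> W \<and> (\<gamma>, \<mu>) \<in> W \<and> \<gamma> \<noteq> \<mu> \<and>
      (\<forall>\<sigma>\<in>underS W \<rho>. infinite_gap W (s \<sigma>) \<mu> \<and> (s \<sigma>, \<mu>) \<in> W \<and> s \<sigma> \<noteq> \<mu>))" for s \<rho> \<mu>
  have "\<exists>s. \<forall>\<rho>. good s \<rho> (s \<rho>)"
  proof (rule dependent_wf_choice)
    show "wf (W - Id)"
      using W by (simp add: omega1_order_def well_order_on_def)
    show "good s \<rho> \<mu> = good s' \<rho> \<mu>" if "\<And>\<sigma>. (\<sigma>, \<rho>) \<in> W - Id \<Longrightarrow> s \<sigma> = s' \<sigma>" for s s' \<rho> \<mu>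
      using that by (simp add: good_def underS_def)
    show "\<exists>\<mu>. good s \<rho> \<mu>" if IH: "\<And>\<sigma>. (\<sigma>, \<rho>) \<in> W - Id \<Longrightarrow> good s \<sigma> (s \<sigma>)" for s \<rho>
    proof (cases "\<rho> \<in> Field W")
      case False
      then show ?thesis by (simp add: good_def)
    next
      case True
      \<comment> \<open>All earlier values together with \<rho> and \<gamma> form a countable set,
        so one application of the bounding lemma meets every demand at once.\<close>
      let ?A = "insert \<rho> (insert \<gamma> (s ` underS W \<rho>))"
      have "s \<sigma> \<in> Field W" if "\<sigma> \<in> underS W \<rho>" for \<sigma>
        using that IH[of \<sigma>] by (auto simp: good_def underS_def Field_def)
      then have "?A \<subseteq> Field W" using True \<gamma> by blast
      moreover have "countable ?A"
        using omega1_countable_underS[OF W] by simp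
      ultimately obtain \<mu> where \<mu>: "\<mu> \<in> Field W" "\<forall>a\<in>?A. infinite_gap W a \<mu> \<and> (a, \<mu>) \<in> W \<and> a \<noteq> \<mu>"
        using infinite_gap_above[OF W, of ?A] by blast
      have "good s \<rho> \<mu>"
        unfolding good_def using \<mu> by simp
      then show ?thesis ..
    qed
  qed
  then obtain s where s: "\<And>\<rho>. good s \<rho> (s \<rho>)" by blast
  show thesis
  proof (rule that[of s])
    show "s \<sigma> \<in> Field W \<and> (\<sigma>, s \<sigma>) \<in> W \<and> (\<gamma>, s \<sigma>) \<in> W \<and> \<gamma> \<noteq> s \<sigma>" if "\<sigma> \<in> Field W" for \<sigma>
      using s[of \<sigma>] that by (simp add: good_def)
    show "infinite_gap W (s \<sigma>) (s \<rho>) \<and> (s \<sigma>, s \<rho>) \<in> W \<and> s \<sigma> \<noteq> s \<rho>" if "(\<sigma>, \<rho>) \<in> W" "\<sigma> \<noteq> \<rho>" for \<sigma> \<rho>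
      using s[of \<rho>] that by (auto simp: good_def underS_def Field_def)
  qed
qed

section \<open>Divisibility and units in valuation domains\<close>

lemma valuation_domain_dvd_total:
  fixes a b :: "'a::idom"
  assumes "valuation_domain TYPE('a)"
  shows "a dvd b \<or> b dvd a"
proof -
  have ideal: "is_ideal {z. x dvd z}" for x :: 'a
    by (simp add: is_ideal_def)
  have "{z. a dvd z} \<subseteq> {z. b dvd z} \<or> {z. b dvd z} \<subseteq> {z. a dvd z}"
    using assms ideal unfolding valuation_domain_def by blast
  then show ?thesis
    unfolding subset_iff mem_Collect_eq using dvd_refl by blast
qed

text \<open>Locality of the ring: if \<open>z\<close> divided \<open>u + z\<close>, it would divide
  the unit \<open>u\<close>, and then \<open>p\<close> would be a unit. By totality
  \<open>u + z\<close> divides \<open>z\<close>, hence \<open>u\<close>.\<close>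

lemma valuation_domain_unit_add:
  fixes u p :: "'a::idom"
  assumes "valuation_domain TYPE('a)" and "u dvd 1" and "\<not> p dvd 1" and "p dvd z"
  shows "u + z dvd 1"
proof -
  have "\<not> z dvd u + z"
    using assms(2-4) by (metis dvd_add_left_iff dvd_refl dvd_trans)
  then have "u + z dvd z"
    using valuation_domain_dvd_total[OF assms(1)] by blast
  then have "u + z dvd u"
    by (metis dvd_add_left_iff dvd_refl)
  then show ?thesis
    using assms(2) dvd_trans by blast
qed

section \<open>Coherent units and special functions\<close>

text \<open>In the intended instance \<open>V\<close> consists of the units congruent to 1 modulo
  \<open>r \<gamma>\<close>, and \<open>E \<sigma>\<close> is congruence modulo the thinned
  \<open>r \<sigma>\<close>. \<open>E_countable\<close> is what essential countability provides;
  \<open>E_infinite\<close> says that the kernel between two levels is infinite, phrased as avoiding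
  any finite set.\<close>

locale unit_tower =
  fixes W :: "'i rel" and V :: "'v::comm_monoid_mult set" and E :: "'i \<Rightarrow> 'v \<Rightarrow> 'v \<Rightarrow> bool"
  assumes wo: "Well_order W"
    and countable_underS: "countable (underS W \<sigma>)"
    and one_V: "1 \<in> V"
    and mult_V: "x \<in> V \<Longrightarrow> y \<in> V \<Longrightarrow> x * y \<in> V"
    and inverse_V: "x \<in> V \<Longrightarrow> \<exists>y\<in>V. x * y = 1"
    and E_refl: "E \<sigma> x x"
    and E_sym: "E \<sigma> x y \<Longrightarrow> E \<sigma> y x"
    and E_trans: "E \<sigma> x y \<Longrightarrow> E \<sigma> y z \<Longrightarrow> E \<sigma> x z"
    and E_mult: "E \<sigma> x y \<Longrightarrow> E \<sigma> (z * x) (z * y)"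
    and E_mono: "(\<sigma>, \<rho>) \<in> W \<Longrightarrow> E \<rho> x y \<Longrightarrow> E \<sigma> x y"
    and E_countable: "\<sigma> \<in> Field W \<Longrightarrow> \<exists>C\<subseteq>V. countable C \<and> (\<forall>v\<in>V. \<exists>c\<in>C. E \<sigma> v c)"
    and E_infinite: "(\<sigma>, \<rho>) \<in> W \<Longrightarrow> \<sigma> \<noteq> \<rho> \<Longrightarrow> finite F \<Longrightarrow> \<exists>v\<in>V. E \<sigma> v 1 \<and> (\<forall>u\<in>F. \<not> E \<rho> v u)"
begin

lemma W_refl: "\<sigma> \<in> Field W \<Longrightarrow> (\<sigma>, \<sigma>) \<in> W"
  using wo by (simp add: order_on_defs refl_on_def)

lemma W_trans: "(\<sigma>, \<tau>) \<in> W \<Longrightarrow> (\<tau>, \<rho>) \<in> W \<Longrightarrow> (\<sigma>, \<rho>) \<in> W"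
  using wo unfolding order_on_defs trans_def by blast

lemma W_antisym: "(\<sigma>, \<tau>) \<in> W \<Longrightarrow> (\<tau>, \<sigma>) \<in> W \<Longrightarrow> \<sigma> = \<tau>"
  using wo unfolding order_on_defs antisym_def by blast

lemma W_total: "\<sigma> \<in> Field W \<Longrightarrow> \<tau> \<in> Field W \<Longrightarrow> (\<sigma>, \<tau>) \<in> W \<or> (\<tau>, \<sigma>) \<in> W"
  using wo W_refl unfolding order_on_defs total_on_def by metis

lemma E_mult2: "E \<sigma> x y \<Longrightarrow> E \<sigma> (x * z) (y * z)"
  using E_mult[of \<sigma> x y z] by (simp add: mult.commute)

lemma E_mult_both: "E \<sigma> x y \<Longrightarrow> E \<sigma> x' y' \<Longrightarrow> E \<sigma> (x * x') (y * y')"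
  using E_mult[of \<sigma> x' y' x] E_mult2[of \<sigma> x y y'] E_trans by blast

text \<open>Take at each step the larger of the current term and the next term of an enumeration of
  the segment. The sequence is only weakly increasing: below an immediate successor it is eventually
  constant.\<close>

lemma underS_cofinal_sequence:
  assumes "underS W \<kappa> \<noteq> {}"
  obtains s :: "nat \<Rightarrow> 'i" where "\<And>n. s n \<in> underS W \<kappa>" and "\<And>n. (s n, s (Suc n)) \<in> W"
    and "\<And>\<sigma>. \<sigma> \<in> underS W \<kappa> \<Longrightarrow> \<exists>n. (\<sigma>, s n) \<in> W"
proof -
  let ?L = "underS W \<kappa>"
  let ?c = "from_nat_into ?L"
  have L: "?L \<subseteq> Field W"
    by (auto simp: underS_def Field_def)
  have cL: "?c n \<in> ?L" for n
    using assms by (simp add: from_nat_into)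
  have "\<exists>s. \<forall>n. (s n \<in> ?L \<and> (?c n, s n) \<in> W) \<and> (s n, s (Suc n)) \<in> W"
  proof (rule dependent_nat_choice)
    show "\<exists>x. x \<in> ?L \<and> (?c 0, x) \<in> W"
      using cL[of 0] W_refl L by blast
    show "\<exists>y. (y \<in> ?L \<and> (?c (Suc n), y) \<in> W) \<and> (x, y) \<in> W" if "x \<in> ?L \<and> (?c n, x) \<in> W" for x n
      using that cL[of "Suc n"] W_total W_refl L by blast
  qed
  then obtain s where s: "\<And>n. s n \<in> ?L" "\<And>n. (?c n, s n) \<in> W" "\<And>n. (s n, s (Suc n)) \<in> W"
    by blast
  show thesis
  proof (rule that[of s])
    show "\<exists>n. (\<sigma>, s n) \<in> W" if "\<sigma> \<in> ?L" for \<sigma>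
      using that s(2) from_nat_into_surj[OF countable_underS] by metis
  qed (use s in auto)
qed

end

section \<open>One level of the recursion\<close>

text \<open>The data on all levels below \<kappa>. \<open>f_mono\<close> is weak because \<sigma> =
  \<rho> is allowed; strictness at \<kappa> comes from the strict bounds kept in the finite parts.
  \<open>f_extend\<close> is the finite extension property, which lets a branch climb without
  breaking finitely many commitments.\<close>

locale unit_tower_stage = unit_tower W V E for W :: "'i rel" and V :: "'v::comm_monoid_mult set" and E +
  fixes \<kappa> :: 'i and e :: "'i \<Rightarrow> 'i \<Rightarrow> 'v" and f :: "'i \<Rightarrow> 'v \<Rightarrow> rat"
  assumes e_refl: "e \<rho> \<rho> = 1"
    and e_V: "\<rho> \<in> underS W \<kappa> \<Longrightarrow> (\<sigma>, \<rho>) \<in> W \<Longrightarrow> e \<rho> \<sigma> \<in> V"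
    and e_coherent: "\<rho> \<in> underS W \<kappa> \<Longrightarrow> (\<sigma>, \<tau>) \<in> W \<Longrightarrow> (\<tau>, \<rho>) \<in> W \<Longrightarrow>
      E \<sigma> (e \<rho> \<sigma>) (e \<rho> \<tau> * e \<tau> \<sigma>)"
    and f_cong: "\<rho> \<in> underS W \<kappa> \<Longrightarrow> x \<in> V \<Longrightarrow> y \<in> V \<Longrightarrow> E \<rho> x y \<Longrightarrow> f \<rho> x = f \<rho> y"
    and f_mono: "\<rho> \<in> underS W \<kappa> \<Longrightarrow> (\<sigma>, \<rho>) \<in> W \<Longrightarrow> x \<in> V \<Longrightarrow> f \<sigma> (x * e \<rho> \<sigma>) \<le> f \<rho> x"
    and f_extend: "\<rho> \<in> underS W \<kappa> \<Longrightarrow> (\<sigma>, \<rho>) \<in> W \<Longrightarrow> finite S \<Longrightarrow> S \<subseteq> V \<times> UNIV \<Longrightarrow> x \<in> V \<Longrightarrow>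
      \<forall>(y, q)\<in>S. f \<sigma> (y * x) < q \<Longrightarrow>
      \<exists>x'\<in>V. E \<sigma> (x' * e \<rho> \<sigma>) x \<and> (\<forall>(y, q)\<in>S. f \<rho> (y * x') < q)"
begin

text \<open>Here \<open>b\<close> is the value at level \<open>\<rho>\<close> of the branch under construction, and \<open>P\<close> is the finite part of
  \<open>f \<kappa>\<close> (up to congruence modulo \<open>E \<kappa>\<close>) decided so far.\<close>
definition promise :: "'i \<Rightarrow> 'v \<Rightarrow> ('v \<times> rat) set \<Rightarrow> bool" where
  "promise \<rho> b P \<longleftrightarrow> b \<in> V \<and> finite P \<and> P \<subseteq> V \<times> UNIV \<and>
     (\<forall>y v. (y, v) \<in> P \<longrightarrow> f \<rho> (y * b) < v) \<and>
     (\<forall>y v y' v'. (y, v) \<in> P \<longrightarrow> (y', v') \<in> P \<longrightarrow> E \<kappa> y y' \<longrightarrow> v = v')"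

text \<open>The pairs in \<open>P\<close> are themselves a finite set of strict bounds, so
  \<open>f_extend\<close> applies with \<open>P\<close> for \<open>S\<close>; the consistency clause
  refers to \<kappa> only and survives the change of level.\<close>

lemma promise_extend:
  assumes "promise \<rho> b P" and "\<rho>' \<in> underS W \<kappa>" and "(\<rho>, \<rho>') \<in> W"
  obtains b' where "promise \<rho>' b' P" and "E \<rho> (b' * e \<rho>' \<rho>) b"
proof -
  have P: "b \<in> V" "finite P" "P \<subseteq> V \<times> UNIV" "\<forall>(y, v)\<in>P. f \<rho> (y * b) < v"
    using assms(1) by (auto simp: promise_def)
  obtain b' where b': "b' \<in> V" "E \<rho> (b' * e \<rho>' \<rho>) b" "\<forall>(y, v)\<in>P. f \<rho>' (y * b') < v"
    using f_extend[OF assms(2,3) P(2,3,1,4)] by blast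
  then have "promise \<rho>' b' P"
    using assms(1) by (auto simp: promise_def)
  then show thesis using that b' by blast
qed

text \<open>If \<open>c\<close> is already decided up to congruence at \<kappa>, nothing changes.
  Otherwise any rational above \<open>f \<rho> (c * b)\<close> is admissible, and adding 1 gives
  one.\<close>

lemma promise_commit:
  assumes "promise \<rho> b P" and "c \<in> V"
  obtains P' where "promise \<rho> b P'" and "P \<subseteq> P'" and "\<exists>(y, v)\<in>P'. E \<kappa> c y"
proof (cases "\<exists>(y, v)\<in>P. E \<kappa> c y")
  case True
  then show ?thesis using that[of P] assms by blast
next
  case False
  have "promise \<rho> b (insert (c, f \<rho> (c * b) + 1) P)"
    using assms False E_sym unfolding promise_def by auto
  moreover have "\<exists>(y, v)\<in>insert (c, f \<rho> (c * b) + 1) P. E \<kappa> c y"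
    using E_refl by auto
  ultimately show ?thesis using that by blast
qed

text \<open>A suitable \<open>x\<close> is \<open>z\<close> times the inverse of \<open>b\<close>
  times an element of the kernel between \<rho> and \<kappa>. As this kernel is infinite,
  \<open>x\<close> can be chosen so that no required \<open>y * x\<close> is congruent at \<kappa>
  to a decided point; values there are then free to lie between \<open>f \<rho> (y * z)\<close> and
  the bounds.\<close>

lemma promise_require:
  assumes P: "promise \<rho> b P" and \<rho>: "\<rho> \<in> underS W \<kappa>"
    and S: "finite S" "S \<subseteq> V \<times> UNIV" and z: "z \<in> V"
    and less: "\<forall>(y, q)\<in>S. f \<rho> (y * z) < q"
  obtains x P' where "promise \<rho> b P'" and "P \<subseteq> P'" and "x \<in> V" and "E \<rho> (x * b) z"
    and "\<forall>(y, q)\<in>S. \<exists>(w, v)\<in>P'. E \<kappa> (y * x) w \<and> v < q"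
proof -
  have bV: "b \<in> V" and finP: "finite P" and PV: "P \<subseteq> V \<times> UNIV"
    using P by (auto simp: promise_def)
  obtain b' where b': "b' \<in> V" "b * b' = 1"
    using inverse_V[OF bV] by blast
  obtain i where i: "\<And>y. y \<in> V \<Longrightarrow> i y \<in> V" "\<And>y. y \<in> V \<Longrightarrow> y * i y = 1"
    using inverse_V by metis
  \<comment> \<open>The values forbidden for \<open>u\<close>: solving
    \<open>y * (z * b') * u = w\<close> for \<open>u\<close> gives these products, one for each
    decided \<open>w\<close> and each required \<open>y\<close>.\<close>
  define F where "F = (\<lambda>(w, y). w * i (y * (z * b'))) ` (fst ` P \<times> fst ` S)"
  have "finite F"
    unfolding F_def using finP S(1) by simp
  then obtain u where u: "u \<in> V" "E \<rho> u 1" "\<And>t. t \<in> F \<Longrightarrow> \<not> E \<kappa> u t"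
    using E_infinite[of \<rho> \<kappa> F] \<rho> by (auto simp: underS_def)
  define x where "x = z * b' * u"
  have xV: "x \<in> V"
    unfolding x_def using mult_V z b' u by simp
  have xb: "E \<rho> (x * b) z"
  proof -
    have "x * b = z * (b * b') * u"
      by (simp add: x_def ac_simps)
    then show ?thesis
      using E_mult[OF u(2), of z] b' by simp
  qed
  have SV: "y \<in> V" if "(y, q) \<in> S" for y q
    using that S(2) by auto
  have fresh: "\<not> E \<kappa> (y * x) w" if yq: "(y, q) \<in> S" and wv: "(w, v) \<in> P" for y q w v
  proof
    assume "E \<kappa> (y * x) w"
    have V: "y * (z * b') \<in> V"
      using SV[OF yq] z b' mult_V by simp
    have "E \<kappa> (i (y * (z * b')) * (y * x)) (i (y * (z * b')) * w)"
      using \<open>E \<kappa> (y * x) w\<close> by (rule E_mult)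
    moreover have "i (y * (z * b')) * (y * x) = y * (z * b') * i (y * (z * b')) * u"
      by (simp add: x_def ac_simps)
    ultimately have "E \<kappa> u (w * i (y * (z * b')))"
      using i(2)[OF V] by (simp add: mult.commute)
    moreover have "w * i (y * (z * b')) \<in> F"
      unfolding F_def using yq wv by force
    ultimately show False using u(3) by blast
  qed
  \<comment> \<open>One value has to respect the bounds of all required points congruent to
    \<open>y\<close> at \<kappa>. These are finitely many, and congruence at \<kappa> implies
    congruence at \<rho>, so \<open>f \<rho> (y * z)\<close> lies below their minimum.\<close>
  have "\<exists>v. f \<rho> (y * z) < v \<and> (\<forall>(y', q)\<in>S. E \<kappa> y y' \<longrightarrow> v < q)" if "(y, q0) \<in> S" for y q0
  proof -
    let ?Q = "{q. \<exists>y'. (y', q) \<in> S \<and> E \<kappa> y y'}"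
    have Q: "finite ?Q" "?Q \<noteq> {}"
      using S(1) that E_refl by (auto intro!: finite_subset[of ?Q "snd ` S"] simp: image_iff Bex_def)
    have "f \<rho> (y * z) < q" if q: "q \<in> ?Q" for q
    proof -
      obtain y' where y': "(y', q) \<in> S" "E \<kappa> y y'" using q by blast
      have "E \<rho> (y * z) (y' * z)"
        using y'(2) E_mono \<rho> E_mult2 unfolding underS_def by blast
      then have "f \<rho> (y * z) = f \<rho> (y' * z)"
        using f_cong[OF \<rho>] mult_V z SV[OF y'(1)] SV[OF \<open>(y, q0) \<in> S\<close>] by blast
      then show ?thesis using less y' by fastforce
    qed
    then have "f \<rho> (y * z) < Min ?Q"
      using Q by simp
    then obtain v where "f \<rho> (y * z) < v" "v < Min ?Q"
      using dense by blast
    then show ?thesis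
      using Q by (intro exI[of _ v]) auto
  qed
  then have "\<exists>v. f \<rho> (y * z) < v \<and> (\<forall>(y', q)\<in>S. E \<kappa> y y' \<longrightarrow> v < q)" if "y \<in> fst ` S" for y
    using that by force
  then obtain v0 where v0: "\<And>y. y \<in> fst ` S \<Longrightarrow> f \<rho> (y * z) < v0 y \<and> (\<forall>(y', q)\<in>S. E \<kappa> y y' \<longrightarrow> v0 y < q)"
    by metis
  \<comment> \<open>A canonical member of each class among the required points. Using
    \<open>v0 (r y)\<close> in place of \<open>v0 y\<close> gives congruent points the same value,
    as the consistency of \<open>P'\<close> demands.\<close>
  define r where "r y = (SOME y'. y' \<in> fst ` S \<and> E \<kappa> y y')" for y
  have r: "r y \<in> fst ` S \<and> E \<kappa> y (r y)" if "y \<in> fst ` S" for y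
    unfolding r_def by (rule someI[of _ y]) (use that E_refl in simp)
  have r_eq: "r y = r y'" if "E \<kappa> y y'" for y y'
    unfolding r_def using that E_sym E_trans by metis
  define P' where "P' = P \<union> (\<lambda>y. (y * x, v0 (r y))) ` (fst ` S)"
  have fS: "y \<in> V" if "y \<in> fst ` S" for y
    using that S(2) by auto
  have "promise \<rho> b P'"
    unfolding promise_def
  proof (intro conjI)
    show "b \<in> V" by (rule bV)
    show "finite P'" unfolding P'_def using finP S(1) by simp
    show "P' \<subseteq> V \<times> UNIV" unfolding P'_def using PV fS mult_V xV by auto
    have new: "f \<rho> (y * x * b) < v0 (r y)" if y: "y \<in> fst ` S" for y
    proof -
      have "E \<rho> (y * x * b) (y * z)"
        using E_mult[OF xb, of y] by (simp add: mult.assoc)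
      moreover have "E \<rho> (y * z) (r y * z)"
        using r[OF y] E_mono \<rho> E_mult2 unfolding underS_def by blast
      ultimately have "E \<rho> (y * x * b) (r y * z)" by (rule E_trans)
      then have "f \<rho> (y * x * b) = f \<rho> (r y * z)"
        using f_cong[OF \<rho>] mult_V z xV bV fS y r[OF y] by simp
      then show ?thesis using v0 r[OF y] by simp
    qed
    show "\<forall>y v. (y, v) \<in> P' \<longrightarrow> f \<rho> (y * b) < v"
    proof (intro allI impI)
      fix y v assume "(y, v) \<in> P'"
      then consider "(y, v) \<in> P" | y0 where "y0 \<in> fst ` S" "y = y0 * x" "v = v0 (r y0)"
        unfolding P'_def by blast
      then show "f \<rho> (y * b) < v"
        by cases (use P new in \<open>simp_all add: promise_def\<close>)
    qed
    have old: "v = v'" if "(y, v) \<in> P" "(y', v') \<in> P" "E \<kappa> y y'" for y v y' v'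
      using P that unfolding promise_def by blast
    have fresh': "\<not> E \<kappa> (y * x) w" if "y \<in> fst ` S" "(w, v) \<in> P" for y w v
      using that fresh by force
    have same: "v0 (r y) = v0 (r y')" if "E \<kappa> (y * x) (y' * x)" for y y'
    proof -
      have "E \<kappa> (y * x * i x) (y' * x * i x)"
        using that by (rule E_mult2)
      then have "E \<kappa> y y'"
        using i(2)[OF xV] by (simp add: mult.assoc)
      then show ?thesis by (simp add: r_eq)
    qed
    have P'_cases: "(y, v) \<in> P \<or> (\<exists>y0\<in>fst ` S. y = y0 * x \<and> v = v0 (r y0))" if "(y, v) \<in> P'" for y v
      using that unfolding P'_def by blast
    show "\<forall>y v y' v'. (y, v) \<in> P' \<longrightarrow> (y', v') \<in> P' \<longrightarrow> E \<kappa> y y' \<longrightarrow> v = v'"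
      using P'_cases old fresh' same E_sym by metis
  qed
  moreover have "\<forall>(y, q)\<in>S. \<exists>(w, v)\<in>P'. E \<kappa> (y * x) w \<and> v < q"
  proof clarify
    fix y q assume yq: "(y, q) \<in> S"
    then have y: "y \<in> fst ` S" by force
    have "v0 (r y) < q"
      using v0[of "r y"] r[OF y] yq E_sym by blast
    moreover have "(y * x, v0 (r y)) \<in> P'"
      unfolding P'_def using y by blast
    ultimately show "\<exists>(w, v)\<in>P'. E \<kappa> (y * x) w \<and> v < q"
      using E_refl by blast
  qed
  ultimately show thesis
    using that[of P' x] xV xb unfolding P'_def by blast
qed


text \<open>Here \<open>b\<close> becomes the row \<open>e \<kappa>\<close> and \<open>g\<close> the
  function \<open>f \<kappa>\<close>; the last clause renews the extension property at \<kappa>, so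
  that the recursion can continue.\<close>

theorem stage_exists:
  assumes \<kappa>: "\<kappa> \<in> Field W"
  obtains b g where "\<And>\<sigma>. \<sigma> \<in> underS W \<kappa> \<Longrightarrow> b \<sigma> \<in> V"
    and "\<And>\<sigma> \<tau>. (\<sigma>, \<tau>) \<in> W \<Longrightarrow> \<tau> \<in> underS W \<kappa> \<Longrightarrow> E \<sigma> (b \<sigma>) (b \<tau> * e \<tau> \<sigma>)"
    and "\<And>x y. E \<kappa> x y \<Longrightarrow> g x = g y"
    and "\<And>\<sigma> x. \<sigma> \<in> underS W \<kappa> \<Longrightarrow> x \<in> V \<Longrightarrow> f \<sigma> (x * b \<sigma>) < g x"
    and "\<And>\<sigma> S x. \<sigma> \<in> underS W \<kappa> \<Longrightarrow> finite S \<Longrightarrow> S \<subseteq> V \<times> UNIV \<Longrightarrow> x \<in> V \<Longrightarrow>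
      \<forall>(y, q)\<in>S. f \<sigma> (y * x) < q \<Longrightarrow>
      \<exists>x'\<in>V. E \<sigma> (x' * b \<sigma>) x \<and> (\<forall>(y, q)\<in>S. g (y * x') < q)"
proof (cases "underS W \<kappa> = {}")
  case True
  \<comment> \<open>Without earlier levels the conditions on \<open>b\<close> are vacuous and a
    constant \<open>g\<close> suffices.\<close>
  show ?thesis
    by (rule that[of "\<lambda>_. 1" "\<lambda>_. 0"]) (simp_all add: True)
next
  case False
  let ?L = "underS W \<kappa>"
  obtain s :: "nat \<Rightarrow> 'i" where sL: "\<And>n. s n \<in> ?L" and sW: "\<And>n. (s n, s (Suc n)) \<in> W"
    and s_cofinal: "\<And>\<sigma>. \<sigma> \<in> ?L \<Longrightarrow> \<exists>n. (\<sigma>, s n) \<in> W"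
    using underS_cofinal_sequence[OF False] by blast
  have s_mono: "(s m, s n) \<in> W" if "m \<le> n" for m n
    using that
  proof (induction n rule: nat_induct_at_least)
    case base
    then show ?case using sL[of m] W_refl by (auto simp: underS_def Field_def)
  next
    case (Suc n)
    then show ?case using sW W_trans by blast
  qed
  obtain C where C: "C \<subseteq> V" "countable C" "\<And>v. v \<in> V \<Longrightarrow> \<exists>c\<in>C. E \<kappa> v c"
    using E_countable[OF \<kappa>] by blast
  have "C \<noteq> {}" using C(3) one_V by blast
  \<comment> \<open>The requirements \<open>(S, x)\<close> with all points taken among the
    representatives in \<open>C\<close>; only countably many have to be served.\<close>
  define T where "T = {S. finite S \<and> S \<subseteq> C \<times> (UNIV :: rat set)} \<times> C"
  have T: "countable T" "T \<noteq> {}"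
    unfolding T_def using C(2) \<open>C \<noteq> {}\<close> by (auto intro!: countable_SIGMA countable_Collect_finite_subset)
  define c where "c n = from_nat_into C n" for n
  \<comment> \<open>The first component of the decoded pair selects the requirement, the second its
    level \<open>s (l n)\<close>. Thus each requirement is met at each level \<open>s m\<close>, and
    \<open>l n \<le> n\<close> guarantees that the level has already been passed.\<close>
  define t where "t n = from_nat_into T (fst (prod_decode n))" for n
  have cV: "c n \<in> V" for n
    using C(1) from_nat_into[OF \<open>C \<noteq> {}\<close>] unfolding c_def by blast
  have tT: "t n \<in> T" for n
    using from_nat_into[OF T(2)] unfolding t_def by blast
  define l where "l n = snd (prod_decode n)" for n
  have l_le: "l n \<le> n" for n
    using le_prod_encode_2[of "l n" "fst (prod_decode n)"] by (simp add: l_def)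
  have t_surj: "\<exists>n. t n = u \<and> l n = m" if u: "u \<in> T" for u m
  proof -
    obtain k where "from_nat_into T k = u"
      using from_nat_into_surj[OF T(1) u] by blast
    then show ?thesis
      by (intro exI[of _ "prod_encode (k, m)"]) (simp add: t_def l_def)
  qed
  \<comment> \<open>A state is the branch value at \<open>s n\<close> with its finite part. Besides
    coherence and growth, step \<open>n\<close> decides \<open>c n\<close> and serves
    \<open>t n\<close> if its bounds hold. As \<open>g\<close> does not exist yet, bounds on its
    values are expressed by pairs in the finite part.\<close>
  define step where "step n p p' \<longleftrightarrow> snd p \<subseteq> snd p' \<and> E (s n) (fst p' * e (s (Suc n)) (s n)) (fst p) \<and>
      (\<exists>(y, v)\<in>snd p'. E \<kappa> (c n) y) \<and>
      ((\<forall>(y, q)\<in>fst (t n). f (s (l n)) (y * snd (t n)) < q) \<longrightarrow>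
        (\<exists>x\<in>V. E (s (l n)) (x * fst p' * e (s (Suc n)) (s (l n))) (snd (t n)) \<and>
          (\<forall>(y, q)\<in>fst (t n). \<exists>(w, v)\<in>snd p'. E \<kappa> (y * x) w \<and> v < q)))"
    for n and p p' :: "'v \<times> ('v \<times> rat) set"
  have "\<exists>p. \<forall>n. promise (s n) (fst (p n)) (snd (p n)) \<and> step n (p n) (p (Suc n))"
  proof (rule dependent_nat_choice)
    show "\<exists>p. promise (s 0) (fst p) (snd p)"
      by (rule exI[of _ "(1, {})"]) (simp add: promise_def one_V)
    show "\<exists>p'. promise (s (Suc n)) (fst p') (snd p') \<and> step n p p'"
      if pn: "promise (s n) (fst p) (snd p)" for p n
    proof -
      obtain b where b: "promise (s (Suc n)) b (snd p)" "E (s n) (b * e (s (Suc n)) (s n)) (fst p)"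
        using promise_extend[OF pn sL sW] by blast
      obtain P1 where P1: "promise (s (Suc n)) b P1" "snd p \<subseteq> P1" "\<exists>(y, v)\<in>P1. E \<kappa> (c n) y"
        using promise_commit[OF b(1) cV] by blast
      have tn: "finite (fst (t n))" "fst (t n) \<subseteq> V \<times> UNIV" "snd (t n) \<in> V"
        using tT[of n] C(1) unfolding T_def by auto
      show ?thesis
      proof (cases "\<forall>(y, q)\<in>fst (t n). f (s (l n)) (y * snd (t n)) < q")
        case True
        have lW: "(s (l n), s (Suc n)) \<in> W"
          using s_mono l_le le_SucI by blast
        \<comment> \<open>\<open>z\<close> lifts the required point to the new level; the congruence
          of \<open>x * b\<close> with \<open>z\<close> obtained there is carried down to
          \<open>s (l n)\<close>.\<close>
        obtain z where z: "z \<in> V" "E (s (l n)) (z * e (s (Suc n)) (s (l n))) (snd (t n))"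
          "\<forall>(y, q)\<in>fst (t n). f (s (Suc n)) (y * z) < q"
          using f_extend[OF sL lW tn True] by blast
        obtain x P2 where P2: "promise (s (Suc n)) b P2" "P1 \<subseteq> P2" "x \<in> V" "E (s (Suc n)) (x * b) z"
          "\<forall>(y, q)\<in>fst (t n). \<exists>(w, v)\<in>P2. E \<kappa> (y * x) w \<and> v < q"
          by (rule promise_require[OF P1(1) sL tn(1,2) z(1,3)]) (rule that)
        have xb: "E (s (l n)) (x * b * e (s (Suc n)) (s (l n))) (snd (t n))"
          using E_mono[OF lW P2(4)] E_mult2 z(2) E_trans by blast
        have "step n p (b, P2)"
          unfolding step_def fst_conv snd_conv
        proof (intro conjI impI)
          show "snd p \<subseteq> P2" using P1(2) P2(2) by blast
          show "\<exists>(y, v)\<in>P2. E \<kappa> (c n) y" using P1(3) P2(2) by blast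
          show "\<exists>x\<in>V. E (s (l n)) (x * b * e (s (Suc n)) (s (l n))) (snd (t n)) \<and>
              (\<forall>(y, q)\<in>fst (t n). \<exists>(w, v)\<in>P2. E \<kappa> (y * x) w \<and> v < q)"
            using P2(3) xb P2(5) by (intro bexI[of _ x] conjI)
        qed (rule b(2))
        then show ?thesis using P2(1) by (intro exI[of _ "(b, P2)"]) simp
      next
        case False
        have "step n p (b, P1)"
          unfolding step_def fst_conv snd_conv
          by (intro conjI impI P1(2,3) b(2)) (erule notE[OF False])
        then show ?thesis using P1(1) by (intro exI[of _ "(b, P1)"]) simp
      qed
    qed
  qed
  then obtain p where p: "\<And>n. promise (s n) (fst (p n)) (snd (p n))" "\<And>n. step n (p n) (p (Suc n))"
    by blast
  define \<beta> where "\<beta> n = fst (p n)" for n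
  define P where "P n = snd (p n)" for n
  have prom: "promise (s n) (\<beta> n) (P n)" for n
    using p(1) by (simp add: \<beta>_def P_def)
  have \<beta>V: "\<beta> n \<in> V" for n
    using prom by (simp add: promise_def)
  have PV: "y \<in> V" if "(y, v) \<in> P n" for y v n
    using prom[of n] that unfolding promise_def by blast
  have P_mono: "P m \<subseteq> P n" if "m \<le> n" for m n
    using lift_Suc_mono_le[of P m n] p(2) that by (simp add: P_def step_def)
  have eL: "e \<rho> \<sigma> \<in> V" if "\<rho> \<in> ?L" "(\<sigma>, \<rho>) \<in> W" for \<rho> \<sigma>
    using e_V that by blast
  have L_down: "\<sigma> \<in> ?L" if "(\<sigma>, \<tau>) \<in> W" "\<tau> \<in> ?L" for \<sigma> \<tau>
    using that W_trans W_antisym unfolding underS_def by blast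
  have \<beta>_chain: "E (s m) (\<beta> n * e (s n) (s m)) (\<beta> m)" if "m \<le> n" for m n
    using that
  proof (induction n rule: nat_induct_at_least)
    case base
    then show ?case by (simp add: e_refl E_refl)
  next
    case (Suc n)
    have "E (s m) (\<beta> (Suc n) * e (s (Suc n)) (s m)) (\<beta> (Suc n) * (e (s (Suc n)) (s n) * e (s n) (s m)))"
      by (rule E_mult) (use e_coherent[OF sL s_mono sW] Suc in blast)
    moreover have "E (s m) (\<beta> (Suc n) * e (s (Suc n)) (s n) * e (s n) (s m)) (\<beta> n * e (s n) (s m))"
    proof (rule E_mult2)
      show "E (s m) (\<beta> (Suc n) * e (s (Suc n)) (s n)) (\<beta> n)"
        using p(2)[of n] E_mono[OF s_mono[OF Suc.hyps]] by (auto simp: step_def \<beta>_def)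
    qed
    ultimately show ?case
      using Suc.IH E_trans by (metis mult.assoc)
  qed
  \<comment> \<open>Any \<open>n\<close> with \<sigma> below \<open>s n\<close> would serve: by
    \<open>b_eq\<close> the value of \<open>b \<sigma>\<close> does not depend on it up to
    \<open>E \<sigma>\<close>.\<close>
  define k where "k \<sigma> = (SOME n. (\<sigma>, s n) \<in> W)" for \<sigma>
  have k: "(\<sigma>, s (k \<sigma>)) \<in> W" if "\<sigma> \<in> ?L" for \<sigma>
    using s_cofinal[OF that] unfolding k_def by (rule someI_ex)
  define b where "b \<sigma> = \<beta> (k \<sigma>) * e (s (k \<sigma>)) \<sigma>" for \<sigma>
  have b_step: "E \<sigma> (\<beta> n * e (s n) \<sigma>) (\<beta> m * e (s m) \<sigma>)" if "(\<sigma>, s m) \<in> W" "m \<le> n" for \<sigma> m n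
  proof -
    have "E \<sigma> (\<beta> n * e (s n) \<sigma>) (\<beta> n * (e (s n) (s m) * e (s m) \<sigma>))"
      by (rule E_mult) (use e_coherent[OF sL that(1) s_mono[OF that(2)]] in blast)
    moreover have "E \<sigma> (\<beta> n * e (s n) (s m) * e (s m) \<sigma>) (\<beta> m * e (s m) \<sigma>)"
      by (rule E_mult2) (use \<beta>_chain[OF that(2)] E_mono that(1) in blast)
    ultimately show ?thesis
      using E_trans by (metis mult.assoc)
  qed
  have b_eq: "E \<sigma> (b \<sigma>) (\<beta> n * e (s n) \<sigma>)" if "\<sigma> \<in> ?L" "(\<sigma>, s n) \<in> W" for \<sigma> n
    using b_step[of \<sigma> n "k \<sigma>"] b_step[of \<sigma> "k \<sigma>" n] k[OF that(1)] that(2) E_sym nat_le_linear[of n "k \<sigma>"]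
    unfolding b_def by blast
  have bV: "b \<sigma> \<in> V" if "\<sigma> \<in> ?L" for \<sigma>
    unfolding b_def using \<beta>V eL sL k that mult_V by simp
  \<comment> \<open>The union of the finite parts, read modulo \<open>E \<kappa>\<close>.
    \<open>P_unique\<close> makes it single-valued, and the decisions on all \<open>c n\<close>
    determine it on \<open>V\<close>. The choice depends on the class of \<open>x\<close> only, so
    invariance holds outside \<open>V\<close> too.\<close>
  define g where "g x = (SOME v. \<exists>n y. (y, v) \<in> P n \<and> E \<kappa> x y)" for x
  have P_unique: "v = v'" if "(y, v) \<in> P n" "(y', v') \<in> P m" "E \<kappa> y y'" for y v y' v' n m
  proof -
    have "(y, v) \<in> P (max m n)" "(y', v') \<in> P (max m n)"
      using that(1,2) P_mono by (meson max.cobounded1 max.cobounded2 subsetD)+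
    then show ?thesis
      using prom[of "max m n"] that(3) unfolding promise_def by blast
  qed
  have g_eq: "g x = v" if "(y, v) \<in> P n" "E \<kappa> x y" for x y v n
  proof -
    have "\<exists>n y. (y, g x) \<in> P n \<and> E \<kappa> x y"
      unfolding g_def by (rule someI[of _ v]) (use that in blast)
    then obtain n' y' where "(y', g x) \<in> P n'" "E \<kappa> x y'" by blast
    then show ?thesis using P_unique that E_sym E_trans by metis
  qed
  have f_L_cong: "f \<sigma> x = f \<sigma> y" if "\<sigma> \<in> ?L" "x \<in> V" "y \<in> V" "E \<kappa> x y" for \<sigma> x y
    using f_cong[OF that(1-3)] E_mono that(1,4) unfolding underS_def by blast
  show ?thesis
  proof (rule that[of b g])
    show "b \<sigma> \<in> V" if "\<sigma> \<in> ?L" for \<sigma>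
      using bV that .
    show "E \<sigma> (b \<sigma>) (b \<tau> * e \<tau> \<sigma>)" if "(\<sigma>, \<tau>) \<in> W" "\<tau> \<in> ?L" for \<sigma> \<tau>
    proof -
      let ?n = "k \<tau>"
      have "E \<sigma> (b \<sigma>) (\<beta> ?n * e (s ?n) \<sigma>)"
        using b_eq L_down that k W_trans by blast
      moreover have "E \<sigma> (\<beta> ?n * e (s ?n) \<sigma>) (\<beta> ?n * (e (s ?n) \<tau> * e \<tau> \<sigma>))"
        by (rule E_mult) (use e_coherent[OF sL that(1) k[OF that(2)]] in blast)
      ultimately show ?thesis
        unfolding b_def[of \<tau>] using E_trans by (metis mult.assoc)
    qed
    show "g x = g y" if "E \<kappa> x y" for x y
    proof -
      have "E \<kappa> x z \<longleftrightarrow> E \<kappa> y z" for z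
        using that E_sym E_trans by blast
      then show ?thesis by (simp add: g_def)
    qed
    show "f \<sigma> (x * b \<sigma>) < g x" if \<sigma>: "\<sigma> \<in> ?L" and x: "x \<in> V" for \<sigma> x
    proof -
      obtain n where n: "E \<kappa> x (c n)"
        using C(3)[OF x] from_nat_into_surj[OF C(2)] unfolding c_def by metis
      obtain y v where yv: "(y, v) \<in> P (Suc n)" "E \<kappa> (c n) y"
        using p(2)[of n] unfolding step_def P_def by auto
      have xy: "E \<kappa> x y" using n yv(2) by (rule E_trans)
      \<comment> \<open>Late enough for \<open>y\<close> to be decided and for \<open>s m\<close> to
        lie above \<sigma>. Then \<open>f_mono\<close> moves the value up to \<open>s m\<close>, and
        the promise there supplies the strict inequality.\<close>
      define m where "m = max (Suc n) (k \<sigma>)"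
      have \<sigma>m: "(\<sigma>, s m) \<in> W"
        using k[OF \<sigma>] s_mono[of "k \<sigma>" m] W_trans unfolding m_def by simp
      have yvm: "(y, v) \<in> P m"
        using yv(1) P_mono[of "Suc n" m] unfolding m_def by auto
      have yV: "y \<in> V" using PV yv(1) by blast
      have "E \<sigma> (x * b \<sigma>) (y * (\<beta> m * e (s m) \<sigma>))"
        using xy E_mono \<sigma> b_eq[OF \<sigma> \<sigma>m] E_mult_both unfolding underS_def by blast
      then have "f \<sigma> (x * b \<sigma>) = f \<sigma> (y * \<beta> m * e (s m) \<sigma>)"
        using f_cong[OF \<sigma>] mult_V x bV[OF \<sigma>] yV \<beta>V eL[OF sL \<sigma>m] by (simp add: mult.assoc)
      also have "\<dots> \<le> f (s m) (y * \<beta> m)"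
        using f_mono[OF sL \<sigma>m] mult_V yV \<beta>V by simp
      also have "\<dots> < v"
        using prom[of m] yvm by (simp add: promise_def)
      finally show ?thesis using g_eq[OF yv(1) xy] by simp
    qed
    show "\<exists>x'\<in>V. E \<sigma> (x' * b \<sigma>) x \<and> (\<forall>(y, q)\<in>S. g (y * x') < q)"
      if \<sigma>: "\<sigma> \<in> ?L" and S: "finite S" "S \<subseteq> V \<times> UNIV" and x: "x \<in> V"
        and less: "\<forall>(y, q)\<in>S. f \<sigma> (y * x) < q" for \<sigma> S x
    proof -
      \<comment> \<open>Replacing points by congruent representatives in \<open>C\<close> turns the
        given requirement into one of those listed in \<open>T\<close>.\<close>
      obtain \<pi> where \<pi>: "\<And>y. y \<in> V \<Longrightarrow> \<pi> y \<in> C \<and> E \<kappa> y (\<pi> y)"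
        using C(3) by metis
      define S' where "S' = (\<lambda>(y, q). (\<pi> y, q)) ` S"
      have S'C: "finite S'" "S' \<subseteq> C \<times> UNIV"
        unfolding S'_def using S \<pi> by auto
      then have S'V: "S' \<subseteq> V \<times> UNIV" using C(1) by blast
      have less': "\<forall>(y, q)\<in>S'. f \<sigma> (y * x) < q"
      proof clarify
        fix y' q assume "(y', q) \<in> S'"
        then obtain y where y: "(y, q) \<in> S" "y' = \<pi> y" unfolding S'_def by auto
        have yV: "y \<in> V" using y(1) S(2) by auto
        have "f \<sigma> (y * x) = f \<sigma> (\<pi> y * x)"
          by (rule f_L_cong[OF \<sigma> mult_V mult_V E_mult2]) (use yV \<pi>[OF yV] C(1) x in auto)
        then show "f \<sigma> (y' * x) < q" using less y by auto
      qed
      text \<open>The construction only handles requirements at the levels \<open>s n\<close>, so \<open>x\<close> is first lifted to one of them.\<close>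
      define m where "m = k \<sigma>"
      have \<sigma>m: "(\<sigma>, s m) \<in> W"
        unfolding m_def by (rule k[OF \<sigma>])
      obtain z0 where z0: "z0 \<in> V" "E \<sigma> (z0 * e (s m) \<sigma>) x" "\<forall>(y, q)\<in>S'. f (s m) (y * z0) < q"
        using f_extend[OF sL \<sigma>m S'C(1) S'V x less'] by blast
      define z where "z = \<pi> z0"
      have zC: "z \<in> C" and z0z: "E \<kappa> z0 z"
        using \<pi>[OF z0(1)] by (auto simp: z_def)
      have zx: "E \<sigma> (z * e (s m) \<sigma>) x"
        using z0z z0(2) E_mono \<sigma> E_mult2 E_sym E_trans unfolding underS_def by blast
      have zS: "\<forall>(y, q)\<in>S'. f (s m) (y * z) < q"
      proof clarify
        fix y q assume yq: "(y, q) \<in> S'"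
        then have yV: "y \<in> V" using S'V by auto
        have "f (s m) (y * z) = f (s m) (y * z0)"
          by (rule f_L_cong[OF sL mult_V mult_V E_mult[OF E_sym]]) (use yV z0z zC z0(1) C(1) in auto)
        then show "f (s m) (y * z) < q" using z0(3) yq by auto
      qed
      obtain n where n: "t n = (S', z)" "l n = m"
        using t_surj[of "(S', z)" m] S'C zC unfolding T_def by auto
      obtain x' where x': "x' \<in> V" "E (s m) (x' * \<beta> (Suc n) * e (s (Suc n)) (s m)) z"
        "\<forall>(y, q)\<in>S'. \<exists>(w, v)\<in>P (Suc n). E \<kappa> (y * x') w \<and> v < q"
        using p(2)[of n] n zS unfolding step_def by (auto simp: \<beta>_def P_def)
      have mW: "(s m, s (Suc n)) \<in> W"
        using s_mono l_le[of n] n(2) by simp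
      have "E \<sigma> (b \<sigma>) (\<beta> m * e (s m) \<sigma>)"
        by (rule b_eq[OF \<sigma> \<sigma>m])
      moreover have "E (s m) (\<beta> m) (\<beta> (Suc n) * e (s (Suc n)) (s m))"
        using \<beta>_chain[of m "Suc n"] l_le[of n] n(2) E_sym by simp
      ultimately have "E \<sigma> (b \<sigma>) (\<beta> (Suc n) * e (s (Suc n)) (s m) * e (s m) \<sigma>)"
        using E_mono[OF \<sigma>m] E_mult2 E_trans by blast
      then have "E \<sigma> (x' * b \<sigma>) (x' * \<beta> (Suc n) * e (s (Suc n)) (s m) * e (s m) \<sigma>)"
        using E_mult by (metis mult.assoc)
      moreover have "E \<sigma> (x' * \<beta> (Suc n) * e (s (Suc n)) (s m) * e (s m) \<sigma>) (z * e (s m) \<sigma>)"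
        using E_mono[OF \<sigma>m x'(2)] by (rule E_mult2)
      ultimately have "E \<sigma> (x' * b \<sigma>) x"
        using zx E_trans by blast
      moreover have "g (y * x') < q" if yq: "(y, q) \<in> S" for y q
      proof -
        have yV: "y \<in> V" using yq S(2) by auto
        have "(\<pi> y, q) \<in> S'" unfolding S'_def using yq by force
        then obtain w v where wv: "(w, v) \<in> P (Suc n)" "E \<kappa> (\<pi> y * x') w" "v < q"
          using x'(3) by blast
        have "E \<kappa> (y * x') w"
          using \<pi>[OF yV] wv(2) E_mult2 E_trans by blast
        then show ?thesis using g_eq wv by simp
      qed
      ultimately show ?thesis using x'(1) by blast
    qed
  qed
qed

end

section \<open>Transfinite recursion over all levels\<close>

context unit_tower
begin

text \<open>The recursion needs an invariant stronger than the conclusion: \<open>good\<close>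
  retains the finite extension property, which \<open>stage_exists\<close> consumes below \<kappa>
  and supplies at \<kappa>.\<close>

theorem special_functions_exist:
  obtains e :: "'i \<Rightarrow> 'i \<Rightarrow> 'v" and f :: "'i \<Rightarrow> 'v \<Rightarrow> rat"
  where "\<And>\<sigma> \<rho>. (\<sigma>, \<rho>) \<in> W \<Longrightarrow> e \<rho> \<sigma> \<in> V"
    and "\<And>\<sigma> \<tau> \<rho>. (\<sigma>, \<tau>) \<in> W \<Longrightarrow> (\<tau>, \<rho>) \<in> W \<Longrightarrow> E \<sigma> (e \<rho> \<sigma>) (e \<rho> \<tau> * e \<tau> \<sigma>)"
    and "\<And>\<sigma> x y. \<sigma> \<in> Field W \<Longrightarrow> E \<sigma> x y \<Longrightarrow> f \<sigma> x = f \<sigma> y"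
    and "\<And>\<sigma> \<rho> x. (\<sigma>, \<rho>) \<in> W \<Longrightarrow> \<sigma> \<noteq> \<rho> \<Longrightarrow> x \<in> V \<Longrightarrow> f \<sigma> (x * e \<rho> \<sigma>) < f \<rho> x"
proof -
  \<comment> \<open>\<open>D \<rho>\<close> holds the pair of branch and function found at level
    \<rho>. The diagonal is set to 1 because the branch is controlled only strictly below
    \<rho>.\<close>
  define e where "e D \<rho> \<sigma> = (if \<sigma> = \<rho> then 1 else fst (D \<rho>) \<sigma>)"
    for D :: "'i \<Rightarrow> ('i \<Rightarrow> 'v) \<times> ('v \<Rightarrow> rat)" and \<rho> \<sigma>
  define f where "f D \<rho> = snd (D \<rho>)" for D :: "'i \<Rightarrow> ('i \<Rightarrow> 'v) \<times> ('v \<Rightarrow> rat)" and \<rho>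
  define good where "good D \<rho> p \<longleftrightarrow> (\<rho> \<in> Field W \<longrightarrow>
      (\<forall>\<sigma>\<in>underS W \<rho>. fst p \<sigma> \<in> V) \<and>
      (\<forall>\<sigma> \<tau>. (\<sigma>, \<tau>) \<in> W \<longrightarrow> \<tau> \<in> underS W \<rho> \<longrightarrow> E \<sigma> (fst p \<sigma>) (fst p \<tau> * e D \<tau> \<sigma>)) \<and>
      (\<forall>x y. E \<rho> x y \<longrightarrow> snd p x = snd p y) \<and>
      (\<forall>\<sigma>\<in>underS W \<rho>. \<forall>x\<in>V. f D \<sigma> (x * fst p \<sigma>) < snd p x) \<and>
      (\<forall>\<sigma>\<in>underS W \<rho>. \<forall>S. finite S \<longrightarrow> S \<subseteq> V \<times> UNIV \<longrightarrow> (\<forall>x\<in>V.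
        (\<forall>(y, q)\<in>S. f D \<sigma> (y * x) < q) \<longrightarrow>
        (\<exists>x'\<in>V. E \<sigma> (x' * fst p \<sigma>) x \<and> (\<forall>(y, q)\<in>S. snd p (y * x') < q)))))" for D \<rho> p
  have "\<exists>D. \<forall>\<rho>. good D \<rho> (D \<rho>)"
  proof (rule dependent_wf_choice)
    show "wf (W - Id)"
      using wo by (simp add: well_order_on_def)
    show "good D \<rho> p = good D' \<rho> p" if "\<And>\<sigma>. (\<sigma>, \<rho>) \<in> W - Id \<Longrightarrow> D \<sigma> = D' \<sigma>" for D D' \<rho> p
    proof -
      have "D \<sigma> = D' \<sigma>" if "\<sigma> \<in> underS W \<rho>" for \<sigma>
        using that \<open>\<And>\<sigma>. (\<sigma>, \<rho>) \<in> W - Id \<Longrightarrow> D \<sigma> = D' \<sigma>\<close> by (simp add: underS_def)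
      then show ?thesis
        unfolding good_def e_def f_def by (simp cong: ball_cong)
    qed
    show "\<exists>p. good D \<kappa> p" if IH: "\<And>\<rho>. (\<rho>, \<kappa>) \<in> W - Id \<Longrightarrow> good D \<rho> (D \<rho>)" for D \<kappa>
    proof (cases "\<kappa> \<in> Field W")
      case False
      then show ?thesis by (simp add: good_def)
    next
      case True
      have good: "good D \<rho> (D \<rho>)" "\<rho> \<in> Field W" if "\<rho> \<in> underS W \<kappa>" for \<rho>
        using that IH by (auto simp: underS_def Field_def)
      have below: "\<sigma> = \<rho> \<or> \<sigma> \<in> underS W \<rho>" if "(\<sigma>, \<rho>) \<in> W" for \<sigma> \<rho>
        using that by (auto simp: underS_def)
      interpret unit_tower_stage W V E \<kappa> "e D" "f D"
      proof
        show "e D \<rho> \<rho> = 1" for \<rho> by (simp add: e_def)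
        show "e D \<rho> \<sigma> \<in> V" if "\<rho> \<in> underS W \<kappa>" "(\<sigma>, \<rho>) \<in> W" for \<rho> \<sigma>
          using good[OF that(1)] below[OF that(2)] one_V unfolding good_def e_def by auto
        show "E \<sigma> (e D \<rho> \<sigma>) (e D \<rho> \<tau> * e D \<tau> \<sigma>)"
          if "\<rho> \<in> underS W \<kappa>" "(\<sigma>, \<tau>) \<in> W" "(\<tau>, \<rho>) \<in> W" for \<rho> \<sigma> \<tau>
        proof (cases "\<tau> = \<rho>")
          case True
          then show ?thesis by (simp add: e_def E_refl)
        next
          case False
          then have "\<tau> \<in> underS W \<rho>" "\<sigma> \<noteq> \<rho>"
            using that W_antisym by (auto simp: underS_def)
          then show ?thesis
            using good[OF that(1)] that(2) False unfolding good_def e_def by auto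
        qed
        show "f D \<rho> x = f D \<rho> y" if "\<rho> \<in> underS W \<kappa>" "E \<rho> x y" for \<rho> x y
          using good[OF that(1)] that(2) unfolding good_def f_def by blast
        show "f D \<sigma> (x * e D \<rho> \<sigma>) \<le> f D \<rho> x" if "\<rho> \<in> underS W \<kappa>" "(\<sigma>, \<rho>) \<in> W" "x \<in> V" for \<rho> \<sigma> x
        proof (cases "\<sigma> = \<rho>")
          case True
          then show ?thesis by (simp add: e_def)
        next
          case False
          then have "f D \<sigma> (x * fst (D \<rho>) \<sigma>) < snd (D \<rho>) x"
            using good[OF that(1)] below[OF that(2)] that(3) unfolding good_def by blast
          then show ?thesis using False by (simp add: e_def f_def)
        qed
        show "\<exists>x'\<in>V. E \<sigma> (x' * e D \<rho> \<sigma>) x \<and> (\<forall>(y, q)\<in>S. f D \<rho> (y * x') < q)"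
          if "\<rho> \<in> underS W \<kappa>" "(\<sigma>, \<rho>) \<in> W" "finite S" "S \<subseteq> V \<times> UNIV" "x \<in> V"
            "\<forall>(y, q)\<in>S. f D \<sigma> (y * x) < q" for \<rho> \<sigma> S x
        proof (cases "\<sigma> = \<rho>")
          case True
          then show ?thesis using that E_refl by (auto simp: e_def intro!: bexI[of _ x])
        next
          case False
          then have "\<sigma> \<in> underS W \<rho>" using below[OF that(2)] by blast
          then show ?thesis
            using good[OF that(1)] that(3-6) False unfolding good_def e_def f_def[of D \<rho>] by simp
        qed
      qed
      show ?thesis
      proof (rule stage_exists[OF True])
        fix b g
        assume "\<And>\<sigma>. \<sigma> \<in> underS W \<kappa> \<Longrightarrow> b \<sigma> \<in> V"
          and "\<And>\<sigma> \<tau>. (\<sigma>, \<tau>) \<in> W \<Longrightarrow> \<tau> \<in> underS W \<kappa> \<Longrightarrow> E \<sigma> (b \<sigma>) (b \<tau> * e D \<tau> \<sigma>)"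
          and "\<And>x y. E \<kappa> x y \<Longrightarrow> g x = g y"
          and "\<And>\<sigma> x. \<sigma> \<in> underS W \<kappa> \<Longrightarrow> x \<in> V \<Longrightarrow> f D \<sigma> (x * b \<sigma>) < g x"
          and "\<And>\<sigma> S x. \<sigma> \<in> underS W \<kappa> \<Longrightarrow> finite S \<Longrightarrow> S \<subseteq> V \<times> UNIV \<Longrightarrow> x \<in> V \<Longrightarrow>
            \<forall>(y, q)\<in>S. f D \<sigma> (y * x) < q \<Longrightarrow>
            \<exists>x'\<in>V. E \<sigma> (x' * b \<sigma>) x \<and> (\<forall>(y, q)\<in>S. g (y * x') < q)"
        then have "good D \<kappa> (b, g)"
          unfolding good_def fst_conv snd_conv by (intro impI conjI ballI allI)
        then show ?thesis ..
      qed
    qed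
  qed
  then obtain D where D: "\<And>\<rho>. good D \<rho> (D \<rho>)" by blast
  have F: "\<sigma> \<in> Field W" "\<rho> \<in> Field W" if "(\<sigma>, \<rho>) \<in> W" for \<sigma> \<rho>
    using that by (auto simp: Field_def)
  have below: "\<sigma> = \<rho> \<or> \<sigma> \<in> underS W \<rho>" if "(\<sigma>, \<rho>) \<in> W" for \<sigma> \<rho>
    using that by (auto simp: underS_def)
  show thesis
  proof (rule that[of "e D" "f D"])
    show "e D \<rho> \<sigma> \<in> V" if "(\<sigma>, \<rho>) \<in> W" for \<sigma> \<rho>
      using D[of \<rho>] F(2)[OF that] below[OF that] one_V unfolding good_def e_def by auto
    show "E \<sigma> (e D \<rho> \<sigma>) (e D \<rho> \<tau> * e D \<tau> \<sigma>)" if "(\<sigma>, \<tau>) \<in> W" "(\<tau>, \<rho>) \<in> W" for \<sigma> \<tau> \<rho>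
    proof (cases "\<tau> = \<rho>")
      case True
      then show ?thesis by (simp add: e_def E_refl)
    next
      case False
      then have "\<tau> \<in> underS W \<rho>" "\<sigma> \<noteq> \<rho>"
        using that W_antisym by (auto simp: underS_def)
      then show ?thesis
        using D[of \<rho>] F(2)[OF that(2)] that(1) False unfolding good_def e_def by auto
    qed
    show "f D \<sigma> x = f D \<sigma> y" if "\<sigma> \<in> Field W" "E \<sigma> x y" for \<sigma> x y
      using D[of \<sigma>] that unfolding good_def f_def by blast
    show "f D \<sigma> (x * e D \<rho> \<sigma>) < f D \<rho> x" if "(\<sigma>, \<rho>) \<in> W" "\<sigma> \<noteq> \<rho>" "x \<in> V" for \<sigma> \<rho> x
    proof -
      have "f D \<sigma> (x * fst (D \<rho>) \<sigma>) < snd (D \<rho>) x"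
        using D[of \<rho>] F(2)[OF that(1)] below[OF that(1)] that(2,3) unfolding good_def by blast
      then show ?thesis using that(2) by (simp add: e_def f_def)
    qed
  qed
qed

end

section \<open>Direct limits of cyclic modules\<close>

lemma cring_RR: "cring (RR :: 'a::idom ring)"
proof (intro cringI abelian_groupI comm_monoidI)
  show "\<exists>y\<in>carrier RR. y \<oplus>\<^bsub>RR\<^esub> x = \<zero>\<^bsub>RR\<^esub>" for x :: 'a
    by (simp add: RR_def exI[of _ "- x"])
qed (simp_all add: RR_def algebra_simps)

text \<open>\<open>cls \<sigma> x\<close> stands for the class of the numerator \<open>x\<close>
  over \<open>r \<sigma>\<close>, so each level is a copy of R modulo \<open>r \<sigma>\<close>, and
  \<open>c \<rho> \<sigma>\<close> acts on numerators. The type of the elements is left abstract to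
  keep the module laws independent of the coding.\<close>

locale direct_limit =
  fixes W :: "'i rel" and r :: "'i \<Rightarrow> 'a::idom" and c :: "'i \<Rightarrow> 'i \<Rightarrow> 'a" and cls :: "'i \<Rightarrow> 'a \<Rightarrow> 'm"
  assumes directed: "\<sigma> \<in> Field W \<Longrightarrow> \<tau> \<in> Field W \<Longrightarrow> \<exists>\<rho>. (\<sigma>, \<rho>) \<in> W \<and> (\<tau>, \<rho>) \<in> W"
    and nonempty: "Field W \<noteq> {}"
    and cls_eq: "\<sigma> \<in> Field W \<Longrightarrow> cls \<sigma> x = cls \<sigma> y \<longleftrightarrow> r \<sigma> dvd x - y"
    and cls_lift: "(\<sigma>, \<rho>) \<in> W \<Longrightarrow> cls \<sigma> x = cls \<rho> (c \<rho> \<sigma> * x)"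
begin

text \<open>The choice operator picks some common level for the arguments;
  \<open>add_well_defined\<close> and \<open>smult_well_defined\<close> show that the result does
  not depend on it.\<close>

definition U :: "('a, 'm) module" where
  "U = \<lparr>carrier = {cls \<sigma> x | \<sigma> x. \<sigma> \<in> Field W}, mult = undefined, one = undefined,
    zero = cls (SOME \<sigma>. \<sigma> \<in> Field W) 0,
    add = (\<lambda>X Y. SOME Z. \<exists>\<rho>\<in>Field W. \<exists>x y. X = cls \<rho> x \<and> Y = cls \<rho> y \<and> Z = cls \<rho> (x + y)),
    smult = (\<lambda>s X. SOME Z. \<exists>\<rho>\<in>Field W. \<exists>x. X = cls \<rho> x \<and> Z = cls \<rho> (s * x))\<rparr>"

lemma FieldW: "(\<sigma>, \<rho>) \<in> W \<Longrightarrow> \<sigma> \<in> Field W" "(\<sigma>, \<rho>) \<in> W \<Longrightarrow> \<rho> \<in> Field W"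
  by (auto simp: Field_def)

lemma cls_carrier: "\<sigma> \<in> Field W \<Longrightarrow> cls \<sigma> x \<in> carrier U"
  by (auto simp: U_def)

lemma zero_cls: "\<sigma> \<in> Field W \<Longrightarrow> \<zero>\<^bsub>U\<^esub> = cls \<sigma> 0"
proof -
  assume \<sigma>: "\<sigma> \<in> Field W"
  define \<tau> where "\<tau> = (SOME \<sigma>. \<sigma> \<in> Field W)"
  have "\<tau> \<in> Field W"
    unfolding \<tau>_def using nonempty by (simp add: some_in_eq)
  then obtain \<rho> where "(\<sigma>, \<rho>) \<in> W" "(\<tau>, \<rho>) \<in> W"
    using \<sigma> directed by blast
  then have "cls \<tau> 0 = cls \<sigma> 0"
    using cls_lift by simp
  then show ?thesis by (simp add: U_def \<tau>_def)
qed

text \<open>At a common later level \<rho> both equations become divisibilities by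
  \<open>r \<rho>\<close>, which can be added.\<close>

lemma add_well_defined:
  assumes "\<sigma> \<in> Field W" "\<tau> \<in> Field W" "cls \<sigma> x = cls \<tau> x'" "cls \<sigma> y = cls \<tau> y'"
  shows "cls \<sigma> (x + y) = cls \<tau> (x' + y')"
proof -
  obtain \<rho> where \<rho>: "(\<sigma>, \<rho>) \<in> W" "(\<tau>, \<rho>) \<in> W"
    using assms directed by blast
  have "r \<rho> dvd c \<rho> \<sigma> * x - c \<rho> \<tau> * x'" "r \<rho> dvd c \<rho> \<sigma> * y - c \<rho> \<tau> * y'"
    using assms(3,4) cls_lift[OF \<rho>(1)] cls_lift[OF \<rho>(2)] cls_eq[OF FieldW(2)[OF \<rho>(1)]] by auto
  then have "r \<rho> dvd (c \<rho> \<sigma> * x - c \<rho> \<tau> * x') + (c \<rho> \<sigma> * y - c \<rho> \<tau> * y')"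
    by (rule dvd_add)
  then have "r \<rho> dvd c \<rho> \<sigma> * (x + y) - c \<rho> \<tau> * (x' + y')"
    by (simp add: algebra_simps)
  then show ?thesis
    using cls_lift[OF \<rho>(1)] cls_lift[OF \<rho>(2)] cls_eq[OF FieldW(2)[OF \<rho>(1)]] by auto
qed

lemma smult_well_defined:
  assumes "\<sigma> \<in> Field W" "\<tau> \<in> Field W" "cls \<sigma> x = cls \<tau> x'"
  shows "cls \<sigma> (s * x) = cls \<tau> (s * x')"
proof -
  obtain \<rho> where \<rho>: "(\<sigma>, \<rho>) \<in> W" "(\<tau>, \<rho>) \<in> W"
    using assms directed by blast
  have "r \<rho> dvd c \<rho> \<sigma> * x - c \<rho> \<tau> * x'"
    using assms(3) cls_lift[OF \<rho>(1)] cls_lift[OF \<rho>(2)] cls_eq[OF FieldW(2)[OF \<rho>(1)]] by auto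
  then have "r \<rho> dvd s * (c \<rho> \<sigma> * x - c \<rho> \<tau> * x')"
    by (rule dvd_mult)
  then have "r \<rho> dvd c \<rho> \<sigma> * (s * x) - c \<rho> \<tau> * (s * x')"
    by (simp add: algebra_simps)
  then show ?thesis
    using cls_lift[OF \<rho>(1)] cls_lift[OF \<rho>(2)] cls_eq[OF FieldW(2)[OF \<rho>(1)]] by auto
qed

lemma add_cls:
  assumes "\<sigma> \<in> Field W"
  shows "cls \<sigma> x \<oplus>\<^bsub>U\<^esub> cls \<sigma> y = cls \<sigma> (x + y)"
  unfolding U_def ring.simps
proof (rule some_equality)
  show "\<exists>\<rho>\<in>Field W. \<exists>x' y'. cls \<sigma> x = cls \<rho> x' \<and> cls \<sigma> y = cls \<rho> y' \<and> cls \<sigma> (x + y) = cls \<rho> (x' + y')"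
    using assms by blast
  show "Z = cls \<sigma> (x + y)"
    if "\<exists>\<rho>\<in>Field W. \<exists>x' y'. cls \<sigma> x = cls \<rho> x' \<and> cls \<sigma> y = cls \<rho> y' \<and> Z = cls \<rho> (x' + y')" for Z
    using that add_well_defined[OF assms] by (elim bexE exE conjE) simp
qed

lemma smult_cls:
  assumes "\<sigma> \<in> Field W"
  shows "s \<odot>\<^bsub>U\<^esub> cls \<sigma> x = cls \<sigma> (s * x)"
  unfolding U_def module.simps
proof (rule some_equality)
  show "\<exists>\<rho>\<in>Field W. \<exists>x'. cls \<sigma> x = cls \<rho> x' \<and> cls \<sigma> (s * x) = cls \<rho> (s * x')"
    using assms by blast
  show "Z = cls \<sigma> (s * x)" if "\<exists>\<rho>\<in>Field W. \<exists>x'. cls \<sigma> x = cls \<rho> x' \<and> Z = cls \<rho> (s * x')" for Z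
    using that smult_well_defined[OF assms] by (elim bexE exE conjE) simp
qed

lemma carrier_obtain:
  assumes "X \<in> carrier U"
  obtains \<sigma> x where "\<sigma> \<in> Field W" "X = cls \<sigma> x"
  using assms by (auto simp: U_def)

lemma carrier_above:
  assumes "X \<in> carrier U" "\<tau> \<in> Field W"
  obtains \<rho> x where "(\<tau>, \<rho>) \<in> W" "X = cls \<rho> x"
proof -
  obtain \<sigma> x where "\<sigma> \<in> Field W" "X = cls \<sigma> x"
    using assms carrier_obtain by blast
  then show thesis
    using directed[OF assms(2)] cls_lift that by metis
qed

lemma carrier_common2:
  assumes "X \<in> carrier U" "Y \<in> carrier U"
  obtains \<rho> x y where "\<rho> \<in> Field W" "X = cls \<rho> x" "Y = cls \<rho> y"
proof -
  obtain \<sigma> x where \<sigma>: "\<sigma> \<in> Field W" "X = cls \<sigma> x"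
    using assms carrier_obtain by blast
  obtain \<rho> y where "(\<sigma>, \<rho>) \<in> W" "Y = cls \<rho> y"
    using carrier_above[OF assms(2) \<sigma>(1)] by blast
  then show thesis
    using that \<sigma> cls_lift FieldW by metis
qed

lemma carrier_common3:
  assumes "X \<in> carrier U" "Y \<in> carrier U" "Z \<in> carrier U"
  obtains \<rho> x y z where "\<rho> \<in> Field W" "X = cls \<rho> x" "Y = cls \<rho> y" "Z = cls \<rho> z"
proof -
  obtain \<sigma> x y where \<sigma>: "\<sigma> \<in> Field W" "X = cls \<sigma> x" "Y = cls \<sigma> y"
    using assms carrier_common2 by blast
  obtain \<rho> z where "(\<sigma>, \<rho>) \<in> W" "Z = cls \<rho> z"
    using carrier_above[OF assms(3) \<sigma>(1)] by blast
  then show thesis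
    using that \<sigma> cls_lift FieldW by metis
qed

lemma abelian_group_U: "abelian_group U"
proof (rule abelian_groupI)
  obtain \<sigma>0 where \<sigma>0: "\<sigma>0 \<in> Field W" using nonempty by blast
  show "\<zero>\<^bsub>U\<^esub> \<in> carrier U"
    using zero_cls[OF \<sigma>0] cls_carrier[OF \<sigma>0] by simp
  show "X \<oplus>\<^bsub>U\<^esub> Y \<in> carrier U" if XY: "X \<in> carrier U" "Y \<in> carrier U" for X Y
    by (rule carrier_common2[OF XY]) (simp add: add_cls cls_carrier)
  show "X \<oplus>\<^bsub>U\<^esub> Y \<oplus>\<^bsub>U\<^esub> Z = X \<oplus>\<^bsub>U\<^esub> (Y \<oplus>\<^bsub>U\<^esub> Z)"
    if XYZ: "X \<in> carrier U" "Y \<in> carrier U" "Z \<in> carrier U" for X Y Z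
    by (rule carrier_common3[OF XYZ]) (simp add: add_cls add.assoc)
  show "X \<oplus>\<^bsub>U\<^esub> Y = Y \<oplus>\<^bsub>U\<^esub> X" if XY: "X \<in> carrier U" "Y \<in> carrier U" for X Y
    by (rule carrier_common2[OF XY]) (simp add: add_cls add.commute)
  show "\<zero>\<^bsub>U\<^esub> \<oplus>\<^bsub>U\<^esub> X = X" if X: "X \<in> carrier U" for X
    by (rule carrier_obtain[OF X]) (simp add: add_cls zero_cls)
  show "\<exists>Y\<in>carrier U. Y \<oplus>\<^bsub>U\<^esub> X = \<zero>\<^bsub>U\<^esub>" if X: "X \<in> carrier U" for X
  proof -
    obtain \<sigma> x where \<sigma>: "\<sigma> \<in> Field W" "X = cls \<sigma> x"
      using carrier_obtain[OF X] by blast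
    then show ?thesis
      using cls_carrier zero_cls by (intro bexI[of _ "cls \<sigma> (- x)"]) (simp_all add: add_cls)
  qed
qed

lemma module_U: "module RR U"
proof (rule moduleI)
  show "cring RR" by (rule cring_RR)
  show "abelian_group U" by (rule abelian_group_U)
  show "s \<odot>\<^bsub>U\<^esub> X \<in> carrier U" if X: "X \<in> carrier U" for s X
    by (rule carrier_obtain[OF X]) (simp add: smult_cls cls_carrier)
  show "(s \<oplus>\<^bsub>RR\<^esub> t) \<odot>\<^bsub>U\<^esub> X = s \<odot>\<^bsub>U\<^esub> X \<oplus>\<^bsub>U\<^esub> t \<odot>\<^bsub>U\<^esub> X" if X: "X \<in> carrier U" for s t X
    by (rule carrier_obtain[OF X]) (simp add: smult_cls add_cls RR_def distrib_right)
  show "s \<odot>\<^bsub>U\<^esub> (X \<oplus>\<^bsub>U\<^esub> Y) = s \<odot>\<^bsub>U\<^esub> X \<oplus>\<^bsub>U\<^esub> s \<odot>\<^bsub>U\<^esub> Y" if XY: "X \<in> carrier U" "Y \<in> carrier U" for s X Y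
    by (rule carrier_common2[OF XY]) (simp add: smult_cls add_cls distrib_left)
  show "(s \<otimes>\<^bsub>RR\<^esub> t) \<odot>\<^bsub>U\<^esub> X = s \<odot>\<^bsub>U\<^esub> (t \<odot>\<^bsub>U\<^esub> X)" if X: "X \<in> carrier U" for s t X
    by (rule carrier_obtain[OF X]) (simp add: smult_cls RR_def mult.assoc)
  show "\<one>\<^bsub>RR\<^esub> \<odot>\<^bsub>U\<^esub> X = X" if X: "X \<in> carrier U" for X
    by (rule carrier_obtain[OF X]) (simp add: smult_cls RR_def)
qed

text \<open>Any two elements lie on a common level, where divisibility of the numerators makes one a
  scalar multiple of the other. Witnesses of incomparability of two submodules would contradict
  this.\<close>

lemma uniserial_U:
  assumes total: "\<And>x y :: 'a. x dvd y \<or> y dvd x"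
  shows "uniserial U"
  unfolding uniserial_def
proof (intro conjI allI impI)
  show "module RR U" by (rule module_U)
  interpret module RR U by (rule module_U)
  fix N1 N2 assume N: "submodule N1 RR U \<and> submodule N2 RR U"
  show "N1 \<subseteq> N2 \<or> N2 \<subseteq> N1"
  proof (rule ccontr)
    assume "\<not> ?thesis"
    then obtain X Y where XY: "X \<in> N1" "X \<notin> N2" "Y \<in> N2" "Y \<notin> N1" by blast
    have "X \<in> carrier U" "Y \<in> carrier U"
      using XY N submoduleE(1) by blast+
    then obtain \<rho> x y where \<rho>: "\<rho> \<in> Field W" "X = cls \<rho> x" "Y = cls \<rho> y"
      using carrier_common2 by blast
    have "(\<exists>s. Y = s \<odot>\<^bsub>U\<^esub> X) \<or> (\<exists>s. X = s \<odot>\<^bsub>U\<^esub> Y)"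
      using total[of x y] \<rho> smult_cls by (metis dvd_def mult.commute)
    moreover have "s \<odot>\<^bsub>U\<^esub> X \<in> N1" "s \<odot>\<^bsub>U\<^esub> Y \<in> N2" for s
      using N XY submoduleE(4) by (auto simp: RR_def)
    ultimately show False using XY by auto
  qed
qed

lemma Ann_cls: "\<sigma> \<in> Field W \<Longrightarrow> Ann U (cls \<sigma> 1) = pideal (r \<sigma>)"
  by (auto simp: Ann_def pideal_def smult_cls zero_cls cls_eq dvd_def)

lemma cyc_cls: "\<sigma> \<in> Field W \<Longrightarrow> cyc U (cls \<sigma> 1) = range (cls \<sigma>)"
  by (simp add: cyc_def smult_cls)

end

text \<open>Elements are classes of pairs of a level and a numerator. As \<open>'a\<close> is
  infinite, pairs are coded by elements of \<open>'a\<close>, and the classes fit into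
  \<open>'a set\<close>. The cocycle condition makes the transition maps compatible, and
  \<open>inj\<close> makes them well defined and injective on residue classes.\<close>

lemma direct_limit_exists:
  fixes W :: "'a::idom rel" and r :: "'a \<Rightarrow> 'a"
  assumes inf: "infinite (UNIV :: 'a set)"
    and refl: "\<And>\<sigma>. \<sigma> \<in> Field W \<Longrightarrow> (\<sigma>, \<sigma>) \<in> W"
    and trans: "\<And>\<sigma> \<tau> \<rho>. (\<sigma>, \<tau>) \<in> W \<Longrightarrow> (\<tau>, \<rho>) \<in> W \<Longrightarrow> (\<sigma>, \<rho>) \<in> W"
    and directed: "\<And>\<sigma> \<tau>. \<sigma> \<in> Field W \<Longrightarrow> \<tau> \<in> Field W \<Longrightarrow> \<exists>\<rho>. (\<sigma>, \<rho>) \<in> W \<and> (\<tau>, \<rho>) \<in> W"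
    and nonempty: "Field W \<noteq> {}"
    and cocycle: "\<And>\<sigma> \<tau> \<rho>. (\<sigma>, \<tau>) \<in> W \<Longrightarrow> (\<tau>, \<rho>) \<in> W \<Longrightarrow> r \<rho> dvd c \<rho> \<sigma> - c \<rho> \<tau> * c \<tau> \<sigma>"
    and inj: "\<And>\<sigma> \<rho> x. (\<sigma>, \<rho>) \<in> W \<Longrightarrow> r \<rho> dvd c \<rho> \<sigma> * x \<longleftrightarrow> r \<sigma> dvd x"
  obtains cls :: "'a \<Rightarrow> 'a \<Rightarrow> 'a set" where "direct_limit W r c cls"
proof -
  have "|UNIV \<times> UNIV :: ('a \<times> 'a) set| =o |UNIV :: 'a set|"
    using inf by (rule card_of_Times_same_infinite)
  then obtain h :: "'a \<times> 'a \<Rightarrow> 'a" where h: "inj h"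
    using card_of_ordIso[of "UNIV \<times> UNIV :: ('a \<times> 'a) set" "UNIV :: 'a set"] by (auto simp: bij_betw_def)
  \<comment> \<open>\<open>R \<rho>\<close> says that two elements have the same image at level
    \<rho>; equality in the limit is agreement at some level.\<close>
  define R where "R \<rho> \<sigma> x \<tau> y \<longleftrightarrow> (\<sigma>, \<rho>) \<in> W \<and> (\<tau>, \<rho>) \<in> W \<and> r \<rho> dvd c \<rho> \<sigma> * x - c \<rho> \<tau> * y" for \<rho> \<sigma> x \<tau> y
  have R_lift: "R \<rho>' \<sigma> x \<tau> y" if "R \<rho> \<sigma> x \<tau> y" "(\<rho>, \<rho>') \<in> W" for \<rho> \<rho>' \<sigma> x \<tau> y
  proof -
    have W: "(\<sigma>, \<rho>) \<in> W" "(\<tau>, \<rho>) \<in> W" and d: "r \<rho> dvd c \<rho> \<sigma> * x - c \<rho> \<tau> * y"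
      using that by (auto simp: R_def)
    have "r \<rho>' dvd c \<rho>' \<rho> * (c \<rho> \<sigma> * x - c \<rho> \<tau> * y)"
      using d inj[OF that(2)] by blast
    moreover have "r \<rho>' dvd (c \<rho>' \<sigma> - c \<rho>' \<rho> * c \<rho> \<sigma>) * x" "r \<rho>' dvd (c \<rho>' \<tau> - c \<rho>' \<rho> * c \<rho> \<tau>) * y"
      using cocycle[OF W(1) that(2)] cocycle[OF W(2) that(2)] by simp_all
    ultimately have "r \<rho>' dvd c \<rho>' \<rho> * (c \<rho> \<sigma> * x - c \<rho> \<tau> * y) +
        ((c \<rho>' \<sigma> - c \<rho>' \<rho> * c \<rho> \<sigma>) * x - (c \<rho>' \<tau> - c \<rho>' \<rho> * c \<rho> \<tau>) * y)"
      by (intro dvd_add dvd_diff)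
    then have "r \<rho>' dvd c \<rho>' \<sigma> * x - c \<rho>' \<tau> * y"
      by (simp add: algebra_simps)
    then show ?thesis
      using W that(2) trans by (auto simp: R_def)
  qed
  have R_sym: "R \<rho> \<tau> y \<sigma> x" if "R \<rho> \<sigma> x \<tau> y" for \<rho> \<sigma> x \<tau> y
    using that unfolding R_def by (metis dvd_minus_iff minus_diff_eq)
  have R_trans: "\<exists>\<rho>. R \<rho> \<sigma> x \<upsilon> z" if "R \<rho>1 \<sigma> x \<tau> y" "R \<rho>2 \<tau> y \<upsilon> z" for \<rho>1 \<rho>2 \<sigma> x \<tau> y \<upsilon> z
  proof -
    have "\<rho>1 \<in> Field W" "\<rho>2 \<in> Field W"
      using that by (auto simp: R_def Field_def)
    then obtain \<rho> where "(\<rho>1, \<rho>) \<in> W" "(\<rho>2, \<rho>) \<in> W"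
      using directed by blast
    then have R: "R \<rho> \<sigma> x \<tau> y" "R \<rho> \<tau> y \<upsilon> z"
      using R_lift[OF that(1)] R_lift[OF that(2)] by auto
    then have "r \<rho> dvd (c \<rho> \<sigma> * x - c \<rho> \<tau> * y) + (c \<rho> \<tau> * y - c \<rho> \<upsilon> * z)"
      unfolding R_def by (intro dvd_add) auto
    then have "R \<rho> \<sigma> x \<upsilon> z"
      using R by (simp add: R_def)
    then show ?thesis ..
  qed
  define Q where "Q \<sigma> x = {(\<tau>, y). \<exists>\<rho>. R \<rho> \<sigma> x \<tau> y}" for \<sigma> x
  define cls where "cls \<sigma> x = h ` Q \<sigma> x" for \<sigma> x
  have cls_iff: "cls \<sigma> x = cls \<tau> y \<longleftrightarrow> (\<exists>\<rho>. R \<rho> \<sigma> x \<tau> y)" if \<tau>: "\<tau> \<in> Field W" for \<sigma> x \<tau> y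
  proof
    assume "cls \<sigma> x = cls \<tau> y"
    then have "Q \<sigma> x = Q \<tau> y"
      unfolding cls_def inj_image_eq_iff[OF h] .
    moreover have "R \<tau> \<tau> y \<tau> y"
      using \<tau> refl by (simp add: R_def)
    ultimately have "(\<tau>, y) \<in> Q \<sigma> x" by (auto simp: Q_def)
    then show "\<exists>\<rho>. R \<rho> \<sigma> x \<tau> y" by (simp add: Q_def)
  next
    assume "\<exists>\<rho>. R \<rho> \<sigma> x \<tau> y"
    then obtain \<rho> where \<rho>: "R \<rho> \<sigma> x \<tau> y" ..
    have "Q \<sigma> x = Q \<tau> y"
      using R_trans[OF \<rho>] R_trans[OF R_sym[OF \<rho>]] unfolding Q_def by auto
    then show "cls \<sigma> x = cls \<tau> y" by (simp add: cls_def)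
  qed
  have "direct_limit W r c cls"
  proof
    show "cls \<sigma> x = cls \<sigma> y \<longleftrightarrow> r \<sigma> dvd x - y" if "\<sigma> \<in> Field W" for \<sigma> x y
    proof -
      \<comment> \<open>By injectivity of the transition maps, agreement at a later level is already
        agreement at \<sigma>.\<close>
      have "R \<rho> \<sigma> x \<sigma> y \<longleftrightarrow> (\<sigma>, \<rho>) \<in> W \<and> r \<sigma> dvd x - y" for \<rho>
        using inj[of \<sigma> \<rho> "x - y"] by (auto simp: R_def right_diff_distrib)
      then show ?thesis using cls_iff[OF that] refl[OF that] by blast
    qed
    show "cls \<sigma> x = cls \<rho> (c \<rho> \<sigma> * x)" if "(\<sigma>, \<rho>) \<in> W" for \<sigma> \<rho> x
    proof -
      have F: "\<rho> \<in> Field W" using that by (auto simp: Field_def)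
      have "r \<rho> dvd (c \<rho> \<sigma> - c \<rho> \<rho> * c \<rho> \<sigma>) * x"
        using cocycle[OF that refl[OF F]] by simp
      then have "R \<rho> \<sigma> x \<rho> (c \<rho> \<sigma> * x)"
        using that refl[OF F] by (simp add: R_def algebra_simps)
      then show ?thesis using cls_iff[OF F] by blast
    qed
  qed (use directed nonempty in auto)
  then show thesis by (rule that)
qed

section \<open>Uniserial modules twisted by units\<close>

lemma Fract_1_eq_iff: "Fract x 1 = Fract y 1 \<longleftrightarrow> x = (y :: 'a::idom)"
  by (simp add: eq_fract)

lemma Fract_1_eq_0_iff: "Fract x 1 = 0 \<longleftrightarrow> x = (0 :: 'a::idom)"
  by (simp add: Zero_fract_def eq_fract)

lemma Fract_1_mult: "Fract (x * y) 1 = Fract x 1 * Fract (y :: 'a::idom) 1"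
  by simp

lemma Fract_1_diff: "Fract (x - y) 1 = Fract x 1 - Fract (y :: 'a::idom) 1"
  by simp

lemma Fract_1_divide: "d \<noteq> 0 \<Longrightarrow> Fract x d = Fract x 1 / Fract (d :: 'a::idom) 1"
  by simp

lemma Rq_iff: "q \<in> Rq \<longleftrightarrow> (\<exists>x. q = Fract x 1)"
  by (auto simp: Rq_def)

lemma Fract_in_Rq: "Fract x 1 \<in> Rq"
  by (auto simp: Rq_def)

lemma Rq_add: "p \<in> Rq \<Longrightarrow> q \<in> Rq \<Longrightarrow> p + q \<in> Rq"
  unfolding Rq_iff by (elim exE, hypsubst, rule exI, simp)

lemma Rq_diff: "p \<in> Rq \<Longrightarrow> q \<in> Rq \<Longrightarrow> p - q \<in> Rq"
  unfolding Rq_iff by (elim exE, hypsubst, rule exI, simp)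

lemma Rq_mult: "p \<in> Rq \<Longrightarrow> q \<in> Rq \<Longrightarrow> p * q \<in> Rq"
  unfolding Rq_iff by (elim exE, hypsubst, rule exI, simp)

lemma Rq_0: "0 \<in> Rq"
  using Fract_in_Rq[of 0] by (simp add: Zero_fract_def)

lemma mem_invR_iff:
  assumes "d \<noteq> (0 :: 'a::idom)"
  shows "q \<in> invR d \<longleftrightarrow> Fract d 1 * q \<in> Rq"
proof -
  have d: "Fract d 1 \<noteq> 0"
    using assms by (simp add: Fract_1_eq_0_iff)
  have "Fract d 1 * q = Fract x 1 \<longleftrightarrow> q = Fract x d" for x
    unfolding Fract_1_divide[OF assms] nonzero_eq_divide_eq[OF d] by (simp only: mult.commute)
  then show ?thesis
    by (simp add: invR_def Rq_iff)
qed

lemma invR_mono: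
  assumes "d dvd d'" "d' \<noteq> (0 :: 'a::idom)"
  shows "invR d \<subseteq> invR d'"
proof
  fix q assume q: "q \<in> invR d"
  obtain k where k: "d' = k * d" using assms(1) by (metis dvd_def mult.commute)
  have "Fract k 1 * (Fract d 1 * q) \<in> Rq"
    using q k assms by (auto simp: mem_invR_iff intro: Rq_mult[OF Fract_in_Rq] simp del: mult_fract)
  then show "q \<in> invR d'"
    unfolding mem_invR_iff[OF assms(2)] by (simp add: k mult.assoc[symmetric])
qed

lemma coset_R_eq_iff: "coset_R x = coset_R y \<longleftrightarrow> x - y \<in> Rq"
proof
  assume "coset_R x = coset_R y"
  then have "x + 0 \<in> coset_R y"
    unfolding coset_R_def using Rq_0 by blast
  then show "x - y \<in> Rq"
    by (auto simp: coset_R_def)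
next
  have *: "coset_R x \<subseteq> coset_R y" if d: "x - y \<in> Rq" for x y :: "'a fract"
  proof
    fix z assume "z \<in> coset_R x"
    then have "z - x \<in> Rq" by (auto simp: coset_R_def)
    then have "(z - x) + (x - y) \<in> Rq" using d by (rule Rq_add)
    then show "z \<in> coset_R y" unfolding coset_R_def by (intro image_eqI[of _ _ "z - y"]) simp_all
  qed
  assume d: "x - y \<in> Rq"
  then have "y - x \<in> Rq" using Rq_diff[OF Rq_0 d] by simp
  then show "coset_R x = coset_R y" using * d by blast
qed

lemma coset_R_Fract_eq_iff:
  assumes "d \<noteq> (0 :: 'a::idom)"
  shows "coset_R (Fract x d) = coset_R (Fract y d) \<longleftrightarrow> d dvd x - y"
proof -
  have d: "Fract d 1 \<noteq> 0"
    using assms by (simp add: Fract_1_eq_0_iff)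
  have "Fract x d - Fract y d = Fract z 1 \<longleftrightarrow> x - y = d * z" for z
  proof -
    have "Fract x d - Fract y d = Fract z 1 \<longleftrightarrow> Fract x 1 - Fract y 1 = Fract d 1 * Fract z 1"
      unfolding Fract_1_divide[OF assms] diff_divide_distrib[symmetric] nonzero_divide_eq_eq[OF d]
      by (simp only: mult.commute)
    also have "\<dots> \<longleftrightarrow> x - y = d * z"
      unfolding Fract_1_mult[symmetric] Fract_1_diff[symmetric] Fract_1_eq_iff ..
    finally show ?thesis .
  qed
  then show ?thesis
    by (simp add: coset_R_eq_iff Rq_iff dvd_def)
qed

text \<open>For a nonunit \<open>s\<close> the products of \<open>s\<close> with the members of a
  coset do not fill a coset; the summand from \<open>Rq\<close> in \<open>cset_smult\<close>
  completes it.\<close>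

lemma cset_smult_coset_R: "cset_smult s (coset_R x) = coset_R (Fract s 1 * x)"
proof (rule Set.set_eqI)
  fix z
  have "z \<in> cset_smult s (coset_R x) \<longleftrightarrow> (\<exists>p\<in>Rq. \<exists>q\<in>Rq. z = Fract s 1 * (x + p) + q)"
    by (auto simp: cset_smult_def coset_R_def)
  also have "\<dots> \<longleftrightarrow> z - Fract s 1 * x \<in> Rq"
  proof
    assume "\<exists>p\<in>Rq. \<exists>q\<in>Rq. z = Fract s 1 * (x + p) + q"
    then obtain p q where pq: "p \<in> Rq" "q \<in> Rq" "z = Fract s 1 * (x + p) + q" by blast
    have "Fract s 1 * p + q \<in> Rq"
      using pq by (intro Rq_add Rq_mult Fract_in_Rq)
    then show "z - Fract s 1 * x \<in> Rq"
      using pq(3) by (simp add: distrib_left)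
  next
    assume "z - Fract s 1 * x \<in> Rq"
    then show "\<exists>p\<in>Rq. \<exists>q\<in>Rq. z = Fract s 1 * (x + p) + q"
      using Rq_0 by (intro bexI[of _ 0] bexI[of _ "z - Fract s 1 * x"]) simp_all
  qed
  also have "\<dots> \<longleftrightarrow> z \<in> coset_R (Fract s 1 * x)"
    by (auto simp: coset_R_def image_iff intro!: bexI[of _ "z - Fract s 1 * x"])
  finally show "z \<in> cset_smult s (coset_R x) \<longleftrightarrow> z \<in> coset_R (Fract s 1 * x)" .
qed

section \<open>Type and isomorphisms of the twisted module\<close>

text \<open>On fractions the transition map is multiplication by the unit
  \<open>e \<rho> \<sigma>\<close>. \<open>c_eq\<close> states the corresponding action on
  numerators without dividing in R.\<close>

locale twisted_limit = direct_limit W r c cls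
  for W :: "'i rel" and r :: "'i \<Rightarrow> 'a::idom" and c and cls :: "'i \<Rightarrow> 'a \<Rightarrow> 'm" +
  fixes e :: "'i \<Rightarrow> 'i \<Rightarrow> 'a"
  assumes valuation: "valuation_domain TYPE('a)"
    and r_nonzero: "\<sigma> \<in> Field W \<Longrightarrow> r \<sigma> \<noteq> 0"
    and r_nonunit: "\<sigma> \<in> Field W \<Longrightarrow> \<not> r \<sigma> dvd 1"
    and c_eq: "(\<sigma>, \<rho>) \<in> W \<Longrightarrow> c \<rho> \<sigma> * r \<sigma> = r \<rho> * e \<rho> \<sigma>"
    and e_unit: "(\<sigma>, \<rho>) \<in> W \<Longrightarrow> e \<rho> \<sigma> dvd 1"
begin

text \<open>That is, D(a) equals \<open>r \<sigma>\<close> times J for a =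
  \<open>cls \<sigma> 1\<close>. If a is \<open>s\<close> times an element of level \<rho>,
  comparing numerators shows that \<open>s * r \<sigma>\<close> divides \<open>r \<rho>\<close>;
  conversely, writing \<open>r \<rho>\<close> as \<open>k * r \<sigma>\<close> exhibits a as a
  multiple of \<open>k\<close>.\<close>

lemma Dv_cls_iff:
  assumes \<sigma>: "\<sigma> \<in> Field W"
  shows "q \<in> Dv U (cls \<sigma> 1) \<longleftrightarrow> q / Fract (r \<sigma>) 1 \<in> (\<Union>\<rho>\<in>Field W. invR (r \<rho>))"
proof -
  have r\<sigma>: "Fract (r \<sigma>) 1 \<noteq> 0"
    using r_nonzero[OF \<sigma>] by (simp add: Fract_1_eq_0_iff)
  show ?thesis
  proof
    assume "q \<in> Dv U (cls \<sigma> 1)"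
    then obtain s u where s: "s \<noteq> 0" "q \<in> invR s" "u \<in> carrier U" "cls \<sigma> 1 = s \<odot>\<^bsub>U\<^esub> u"
      unfolding Dv_def by blast
    obtain \<rho> x where \<rho>: "(\<sigma>, \<rho>) \<in> W" "u = cls \<rho> x"
      using carrier_above[OF s(3) \<sigma>] by blast
    have \<rho>F: "\<rho> \<in> Field W" using \<rho>(1) FieldW by blast
    have "cls \<rho> (c \<rho> \<sigma> * 1) = cls \<rho> (s * x)"
      using s(4) cls_lift[OF \<rho>(1), of 1] smult_cls[OF \<rho>F] \<rho>(2) by simp
    then have "r \<rho> dvd c \<rho> \<sigma> - s * x"
      using cls_eq[OF \<rho>F] by simp
    then obtain w where w: "c \<rho> \<sigma> - s * x = r \<rho> * w" ..
    \<comment> \<open>The error term is a multiple of the nonunit \<open>r \<sigma>\<close>, so the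
      perturbed transition unit can still be inverted.\<close>
    have "e \<rho> \<sigma> + - (r \<sigma> * w) dvd 1"
      by (rule valuation_domain_unit_add[OF valuation e_unit[OF \<rho>(1)] r_nonunit[OF \<sigma>]]) simp
    then obtain t where t: "(e \<rho> \<sigma> - r \<sigma> * w) * t = 1"
      by (metis dvd_def uminus_add_conv_diff add.commute)
    have "r \<rho> * (e \<rho> \<sigma> - r \<sigma> * w) = s * x * r \<sigma>"
    proof -
      have "(c \<rho> \<sigma> - s * x) * r \<sigma> = r \<rho> * w * r \<sigma>" by (simp add: w)
      then show ?thesis using c_eq[OF \<rho>(1)] by (simp add: algebra_simps)
    qed
    then have "r \<rho> * ((e \<rho> \<sigma> - r \<sigma> * w) * t) = s * x * r \<sigma> * t"
      by (metis mult.assoc)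
    then have r\<rho>: "r \<rho> = x * t * s * r \<sigma>"
      unfolding t by (simp add: mult_ac)
    have "Fract (r \<rho>) 1 * (q / Fract (r \<sigma>) 1) = Fract (x * t) 1 * (Fract s 1 * q)"
      unfolding r\<rho> Fract_1_mult[of _ "r \<sigma>"] Fract_1_mult[of _ s] using r\<sigma> by (simp del: mult_fract)
    also have "\<dots> \<in> Rq"
      using s(1,2) by (auto simp: mem_invR_iff intro: Rq_mult[OF Fract_in_Rq] simp del: mult_fract)
    finally have "q / Fract (r \<sigma>) 1 \<in> invR (r \<rho>)"
      by (simp add: mem_invR_iff r_nonzero[OF \<rho>F])
    then show "q / Fract (r \<sigma>) 1 \<in> (\<Union>\<rho>\<in>Field W. invR (r \<rho>))"
      using \<rho>F by blast
  next
    assume "q / Fract (r \<sigma>) 1 \<in> (\<Union>\<rho>\<in>Field W. invR (r \<rho>))"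
    then obtain \<tau> where \<tau>: "\<tau> \<in> Field W" "q / Fract (r \<sigma>) 1 \<in> invR (r \<tau>)" by blast
    obtain \<rho> where \<rho>: "(\<sigma>, \<rho>) \<in> W" "(\<tau>, \<rho>) \<in> W"
      using directed \<sigma> \<tau>(1) by blast
    have \<rho>F: "\<rho> \<in> Field W" using \<rho>(1) FieldW by blast
    \<comment> \<open>Cancelling the unit \<open>e \<rho> \<upsilon>\<close> in \<open>c_eq\<close>
      yields one \<open>k\<close> for both equations.\<close>
    have r_dvd: "\<exists>k. r \<rho> = k * r \<upsilon> \<and> c \<rho> \<upsilon> = k * e \<rho> \<upsilon>" if \<upsilon>: "(\<upsilon>, \<rho>) \<in> W" for \<upsilon>
    proof -
      obtain t where t: "e \<rho> \<upsilon> * t = 1"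
        using e_unit[OF \<upsilon>] by (metis dvd_def)
      have "c \<rho> \<upsilon> * t * r \<upsilon> = r \<rho> * (e \<rho> \<upsilon> * t)"
        using c_eq[OF \<upsilon>] by (metis mult.assoc mult.commute)
      moreover have "c \<rho> \<upsilon> = c \<rho> \<upsilon> * t * e \<rho> \<upsilon>"
        using t by (metis mult.assoc mult.commute mult_1_right)
      ultimately show ?thesis using t by (metis mult_1_right)
    qed
    obtain k where k: "r \<rho> = k * r \<sigma>" "c \<rho> \<sigma> = k * e \<rho> \<sigma>"
      using r_dvd[OF \<rho>(1)] by blast
    have "k \<noteq> 0" using k(1) r_nonzero[OF \<rho>F] by auto
    moreover have "cls \<sigma> 1 = k \<odot>\<^bsub>U\<^esub> cls \<rho> (e \<rho> \<sigma>)"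
      using cls_lift[OF \<rho>(1), of 1] smult_cls[OF \<rho>F] k(2) by simp
    moreover have "q \<in> invR k"
    proof -
      have "r \<tau> dvd r \<rho>" using r_dvd[OF \<rho>(2)] by auto
      then have "q / Fract (r \<sigma>) 1 \<in> invR (r \<rho>)"
        using invR_mono[OF _ r_nonzero[OF \<rho>F]] \<tau>(2) by blast
      then have "Fract (r \<rho>) 1 * (q / Fract (r \<sigma>) 1) \<in> Rq"
        by (simp add: mem_invR_iff r_nonzero[OF \<rho>F])
      then have "Fract k 1 * q \<in> Rq"
        unfolding k(1) Fract_1_mult using r\<sigma> by (simp del: mult_fract)
      then show ?thesis using \<open>k \<noteq> 0\<close> by (simp add: mem_invR_iff)
    qed
    ultimately show "q \<in> Dv U (cls \<sigma> 1)"
      unfolding Dv_def using cls_carrier[OF \<rho>F] by blast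
  qed
qed

text \<open>Division by \<open>r \<sigma>\<close> carries D(a) onto J and Ann(a) onto R. The lift is
  genuinely linear, so the defects in \<open>quot_iso\<close> are 0.\<close>

lemma has_type_U: "has_type U (\<Union>\<rho>\<in>Field W. invR (r \<rho>)) Rq"
proof -
  let ?J = "\<Union>\<rho>\<in>Field W. invR (r \<rho>)"
  obtain \<sigma> where \<sigma>: "\<sigma> \<in> Field W" using nonempty by blast
  define d where "d = Fract (r \<sigma>) 1"
  have d: "d \<noteq> 0"
    using r_nonzero[OF \<sigma>] by (simp add: d_def Fract_1_eq_0_iff)
  have D: "q \<in> Dv U (cls \<sigma> 1) \<longleftrightarrow> q / d \<in> ?J" for q
    unfolding d_def by (rule Dv_cls_iff[OF \<sigma>])
  have A: "q / d \<in> Rq \<longleftrightarrow> q \<in> embR (Ann U (cls \<sigma> 1))" for q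
  proof -
    have "q / d \<in> Rq \<longleftrightarrow> (\<exists>x. q = d * Fract x 1)"
      unfolding Rq_iff using d by (auto simp: field_simps)
    also have "\<dots> \<longleftrightarrow> q \<in> embR (Ann U (cls \<sigma> 1))"
      by (auto simp: Ann_cls[OF \<sigma>] embR_def pideal_def d_def)
    finally show ?thesis .
  qed
  have "quot_iso (Dv U (cls \<sigma> 1)) (embR (Ann U (cls \<sigma> 1))) ?J Rq"
    unfolding quot_iso_def
  proof (intro exI[of _ "\<lambda>q. q / d"] conjI ballI allI)
    show "(x + y) / d - x / d - y / d \<in> Rq" for x y
      by (simp add: add_divide_distrib Rq_0)
    show "Fract s 1 * x / d - Fract s 1 * (x / d) \<in> Rq" for s x
      by (simp add: Rq_0)
    show "\<exists>x\<in>Dv U (cls \<sigma> 1). y - x / d \<in> Rq" if "y \<in> ?J" for y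
      using that d by (intro bexI[of _ "d * y"]) (simp_all add: Rq_0 D)
  qed (simp_all add: D A)
  moreover have "cls \<sigma> 1 \<noteq> \<zero>\<^bsub>U\<^esub>"
    using zero_cls[OF \<sigma>] cls_eq[OF \<sigma>] r_nonunit[OF \<sigma>] by simp
  ultimately show ?thesis
    unfolding has_type_def using cls_carrier[OF \<sigma>] by blast
qed

text \<open>Surjectivity provides \<open>s\<close> with \<open>s * u\<close> congruent to 1 modulo
  the nonunit \<open>r \<sigma>\<close>; hence \<open>s * u\<close>, and with it \<open>u\<close>,
  is a unit.\<close>

lemma Isos_obtain_unit:
  assumes \<sigma>: "\<sigma> \<in> Field W" and \<psi>: "\<psi> \<in> Isos U (cls \<sigma> 1) (r \<sigma>)"
  shows "\<exists>u. u dvd 1 \<and> \<psi> (cls \<sigma> 1) = coset_R (Fract u (r \<sigma>))"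
proof -
  have bij: "bij_betw \<psi> (range (cls \<sigma>)) (coset_R ` invR (r \<sigma>))"
    and smult: "\<And>s u. u \<in> range (cls \<sigma>) \<Longrightarrow> \<psi> (s \<odot>\<^bsub>U\<^esub> u) = cset_smult s (\<psi> u)"
    using \<psi> unfolding Isos_def cyc_cls[OF \<sigma>] by auto
  have "\<psi> (cls \<sigma> 1) \<in> coset_R ` invR (r \<sigma>)"
    using bij bij_betwE by blast
  then obtain u where u: "\<psi> (cls \<sigma> 1) = coset_R (Fract u (r \<sigma>))"
    unfolding invR_def by blast
  have "coset_R (Fract 1 (r \<sigma>)) \<in> \<psi> ` range (cls \<sigma>)"
    using bij unfolding bij_betw_def invR_def by blast
  then obtain s where "\<psi> (cls \<sigma> s) = coset_R (Fract 1 (r \<sigma>))"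
    by auto
  moreover have "\<psi> (cls \<sigma> s) = coset_R (Fract (s * u) (r \<sigma>))"
    using smult[of "cls \<sigma> 1" s] by (simp add: smult_cls[OF \<sigma>] u cset_smult_coset_R)
  ultimately have "r \<sigma> dvd s * u - 1"
    using coset_R_Fract_eq_iff[OF r_nonzero[OF \<sigma>]] by metis
  then have "1 + (s * u - 1) dvd 1"
    by (intro valuation_domain_unit_add[OF valuation _ r_nonunit[OF \<sigma>]]) simp
  then have "u dvd 1"
    by (simp add: dvd_mult_right)
  then show ?thesis using u by blast
qed

text \<open>The generator of level \<sigma> is \<open>c \<rho> \<sigma>\<close> times that of level
  \<rho>. Linearity of \<phi> and \<open>c_eq\<close> turn its image into a fraction with numerator
  \<open>e \<rho> \<sigma> * v\<close> over \<open>r \<sigma>\<close>.\<close>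

lemma Isos_extend_unit:
  assumes W: "(\<sigma>, \<rho>) \<in> W" and \<phi>: "\<phi> \<in> Isos U (cls \<rho> 1) (r \<rho>)"
    and ext: "\<phi> (cls \<sigma> 1) = coset_R (Fract u (r \<sigma>))" and v: "\<phi> (cls \<rho> 1) = coset_R (Fract v (r \<rho>))"
  shows "r \<sigma> dvd e \<rho> \<sigma> * v - u"
proof -
  have F: "\<sigma> \<in> Field W" "\<rho> \<in> Field W" using W FieldW by auto
  have "\<phi> (c \<rho> \<sigma> \<odot>\<^bsub>U\<^esub> cls \<rho> 1) = cset_smult (c \<rho> \<sigma>) (\<phi> (cls \<rho> 1))"
    using \<phi> unfolding Isos_def cyc_cls[OF F(2)] by auto
  moreover have "c \<rho> \<sigma> \<odot>\<^bsub>U\<^esub> cls \<rho> 1 = cls \<sigma> 1"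
    using cls_lift[OF W, of 1] smult_cls[OF F(2)] by simp
  ultimately have "coset_R (Fract u (r \<sigma>)) = coset_R (Fract (c \<rho> \<sigma> * v) (r \<rho>))"
    by (simp add: ext v cset_smult_coset_R)
  also have "Fract (c \<rho> \<sigma> * v) (r \<rho>) = Fract (e \<rho> \<sigma> * v) (r \<sigma>)"
    using c_eq[OF W] r_nonzero F by (simp add: eq_fract mult_ac)
  finally show ?thesis
    using coset_R_Fract_eq_iff[OF r_nonzero[OF F(1)]] by metis
qed

end


section \<open>Assembly for the given type\<close>

theorem mainTheorem7:
  fixes J :: "'a::idom fract set"
  assumes "valuation_domain TYPE('a)"
    and "ordIso2 (card_of (UNIV :: 'a set)) (cardSuc natLeq)"
    and "Rsubmod_Q J" and "Rq \<subseteq> J"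
    and "essentially_countable J"
    and "\<not> countably_generated J"
  shows "\<exists>U :: ('a, 'a set) module. uniserial U \<and> has_type U J Rq \<and> explicitly_nonstandard U J"
proof -
  obtain W :: "('a \<times> 'a) set" and r \<gamma> where repr: "type_repr W r J" and \<gamma>: "\<gamma> \<in> Field W"
    and countable_above: "\<And>\<sigma>. \<sigma> \<in> Field W \<Longrightarrow> (\<gamma>, \<sigma>) \<in> W \<Longrightarrow> \<gamma> \<noteq> \<sigma> \<Longrightarrow>
      countable_quot (pideal (r \<gamma>)) (pideal (r \<sigma>))"
    using assms(5) unfolding essentially_countable_def by blast
  have \<omega>: "omega1_order W" and r0: "\<And>\<sigma>. \<sigma> \<in> Field W \<Longrightarrow> r \<sigma> \<noteq> 0"
    and strict: "\<And>\<sigma> \<rho>. (\<sigma>, \<rho>) \<in> W \<Longrightarrow> \<sigma> \<noteq> \<rho> \<Longrightarrow> r \<sigma> dvd r \<rho> \<and> \<not> r \<rho> dvd r \<sigma>"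
    and J: "J = (\<Union>\<sigma>\<in>Field W. invR (r \<sigma>))"
    using repr unfolding type_repr_def by blast+
  have mono: "r \<sigma> dvd r \<rho>" if "(\<sigma>, \<rho>) \<in> W" for \<sigma> \<rho>
    using strict[OF that] by (cases "\<sigma> = \<rho>") auto
  have wo: "Well_order W"
    using \<omega> by (simp add: omega1_order_def)
  have W_refl: "(\<sigma>, \<sigma>) \<in> W" if "\<sigma> \<in> Field W" for \<sigma>
    using wo that by (simp add: order_on_defs refl_on_def)
  have FW: "\<sigma> \<in> Field W" "\<rho> \<in> Field W" if "(\<sigma>, \<rho>) \<in> W" for \<sigma> \<rho>
    using that by (auto simp: Field_def)
  obtain s where s: "\<And>\<sigma>. \<sigma> \<in> Field W \<Longrightarrow> s \<sigma> \<in> Field W \<and> (\<sigma>, s \<sigma>) \<in> W \<and> (\<gamma>, s \<sigma>) \<in> W \<and> \<gamma> \<noteq> s \<sigma>"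
    and s_gap: "\<And>\<sigma> \<rho>. (\<sigma>, \<rho>) \<in> W \<Longrightarrow> \<sigma> \<noteq> \<rho> \<Longrightarrow> infinite_gap W (s \<sigma>) (s \<rho>) \<and> (s \<sigma>, s \<rho>) \<in> W \<and> s \<sigma> \<noteq> s \<rho>"
    by (rule infinite_gap_reindexing[OF \<omega> \<gamma>]) (rule that)
  define d where "d = r \<gamma>"
  define r' where "r' \<sigma> = r (s \<sigma>)" for \<sigma>
  have r'0: "r' \<sigma> \<noteq> 0" if "\<sigma> \<in> Field W" for \<sigma>
    using that s r0 by (simp add: r'_def)
  have nonunit_above: "\<not> r \<sigma> dvd 1" if "(\<gamma>, \<sigma>) \<in> W" "\<gamma> \<noteq> \<sigma>" for \<sigma>
    using strict[OF that] by (meson dvd_trans one_dvd)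
  have r'_nonunit: "\<not> r' \<sigma> dvd 1" if "\<sigma> \<in> Field W" for \<sigma>
    using that s nonunit_above by (simp add: r'_def)
  have r'_mono: "r' \<sigma> dvd r' \<rho>" if "(\<sigma>, \<rho>) \<in> W" for \<sigma> \<rho>
    using s_gap[OF that] mono by (cases "\<sigma> = \<rho>") (auto simp: r'_def)
  have repr': "type_repr W r' J"
    unfolding type_repr_def
  proof (intro conjI)
    show "\<forall>\<tau> \<sigma>. (\<tau>, \<sigma>) \<in> W \<and> \<tau> \<noteq> \<sigma> \<longrightarrow> r' \<tau> dvd r' \<sigma> \<and> \<not> r' \<sigma> dvd r' \<tau>"
      using s_gap strict unfolding r'_def by blast
    show "J = (\<Union>\<sigma>\<in>Field W. invR (r' \<sigma>))"
    proof
      show "J \<subseteq> (\<Union>\<sigma>\<in>Field W. invR (r' \<sigma>))"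
        unfolding J r'_def using s mono invR_mono r0 by (meson UN_mono order_refl)
      show "(\<Union>\<sigma>\<in>Field W. invR (r' \<sigma>)) \<subseteq> J"
        unfolding J r'_def using s by blast
    qed
  qed (use \<omega> r'0 in auto)
  \<comment> \<open>Restricting to units congruent to 1 modulo \<open>d\<close> makes every level
    countable; the group of all units need not be countable modulo
    \<open>r' \<sigma>\<close>.\<close>
  define V where "V = {u. u dvd 1 \<and> d dvd u - 1}"
  define E where "E \<sigma> x y \<longleftrightarrow> r' \<sigma> dvd x - y" for \<sigma> x y
  have d_dvd: "d dvd r' \<sigma>" if "\<sigma> \<in> Field W" for \<sigma>
    using s[OF that] mono by (simp add: d_def r'_def)
  have V_mult: "x * y \<in> V" if "x \<in> V" "y \<in> V" for x y
  proof -
    have "d dvd x * (y - 1) + (x - 1)"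
      using that by (simp add: V_def)
    then have "d dvd x * y - 1" by (simp add: algebra_simps)
    then show ?thesis
      using that mult_dvd_mono[of x 1 y 1] by (simp add: V_def)
  qed
  interpret unit_tower W V E
  proof
    show "Well_order W" by (rule wo)
    show "countable (underS W \<sigma>)" for \<sigma>
      using \<omega> by (rule omega1_countable_underS)
    show "1 \<in> V" by (simp add: V_def)
    show "x * y \<in> V" if "x \<in> V" "y \<in> V" for x y
      using V_mult that .
    show "\<exists>y\<in>V. x * y = 1" if x: "x \<in> V" for x
    proof -
      have "x dvd 1" using x by (simp add: V_def)
      then obtain y where y: "x * y = 1" by (metis dvd_def)
      have "y - 1 = - (y * (x - 1))"
        using y by (simp add: algebra_simps)
      then have "d dvd y - 1"
        using x by (simp add: V_def)
      moreover have "y dvd 1"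
        using y by (metis dvd_triv_right)
      ultimately show ?thesis
        using y by (auto simp: V_def)
    qed
    show "E \<sigma> x x" for \<sigma> x by (simp add: E_def)
    show "E \<sigma> y x" if "E \<sigma> x y" for \<sigma> x y
      using that unfolding E_def by (metis dvd_minus_iff minus_diff_eq)
    show "E \<sigma> x z" if "E \<sigma> x y" "E \<sigma> y z" for \<sigma> x y z
      using dvd_add[of "r' \<sigma>" "x - y" "y - z"] that by (simp add: E_def)
    show "E \<sigma> (z * x) (z * y)" if "E \<sigma> x y" for \<sigma> x y z
      using that unfolding E_def by (metis dvd_mult right_diff_distrib)
    show "E \<sigma> x y" if "(\<sigma>, \<rho>) \<in> W" "E \<rho> x y" for \<sigma> \<rho> x y
      using r'_mono[OF that(1)] that(2) dvd_trans unfolding E_def by blast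
    show "\<exists>C\<subseteq>V. countable C \<and> (\<forall>v\<in>V. \<exists>c\<in>C. E \<sigma> v c)" if \<sigma>: "\<sigma> \<in> Field W" for \<sigma>
    proof -
      \<comment> \<open>\<open>\<phi> v\<close> is the coset of \<open>v - 1\<close>, an element of
        a quotient that is countable by essential countability; \<open>inv_into\<close> then picks
        one unit from \<open>V\<close> per coset.\<close>
      define \<phi> where "\<phi> v = (\<lambda>k. (v - 1) + k) ` pideal (r' \<sigma>)" for v
      have "countable ((\<lambda>x. (\<lambda>k. x + k) ` pideal (r' \<sigma>)) ` pideal d)"
        using countable_above[of "s \<sigma>"] s[OF \<sigma>] by (simp add: countable_quot_def d_def r'_def)
      moreover have "\<phi> ` V \<subseteq> (\<lambda>x. (\<lambda>k. x + k) ` pideal (r' \<sigma>)) ` pideal d"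
        unfolding \<phi>_def V_def pideal_def by (auto simp: dvd_def)
      ultimately have "countable (\<phi> ` V)"
        using countable_subset by blast
      then have "countable (inv_into V \<phi> ` \<phi> ` V)"
        by simp
      moreover have "inv_into V \<phi> ` \<phi> ` V \<subseteq> V"
        by (auto intro: inv_into_into)
      moreover have "E \<sigma> v (inv_into V \<phi> (\<phi> v))" if "v \<in> V" for v
      proof -
        have "\<phi> (inv_into V \<phi> (\<phi> v)) = \<phi> v"
          using that by (simp add: f_inv_into_f)
        moreover have "v - 1 + 0 \<in> \<phi> v"
          unfolding \<phi>_def pideal_def by (intro imageI CollectI exI[of _ 0]) simp
        ultimately have "v - 1 + 0 \<in> \<phi> (inv_into V \<phi> (\<phi> v))" by simp
        then obtain k where "v - 1 = inv_into V \<phi> (\<phi> v) - 1 + r' \<sigma> * k"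
          unfolding \<phi>_def[of "inv_into V \<phi> (\<phi> v)"] pideal_def by auto
        then have "v - inv_into V \<phi> (\<phi> v) = r' \<sigma> * k"
          by (simp add: algebra_simps)
        then show ?thesis by (simp add: E_def)
      qed
      ultimately show ?thesis
        by (intro exI[of _ "inv_into V \<phi> ` \<phi> ` V"]) blast
    qed
    show "\<exists>v\<in>V. E \<sigma> v 1 \<and> (\<forall>u\<in>F. \<not> E \<rho> v u)" if \<sigma>\<rho>: "(\<sigma>, \<rho>) \<in> W" "\<sigma> \<noteq> \<rho>" and F: "finite F" for \<sigma> \<rho> F
    proof (rule ccontr)
      assume contr: "\<not> ?thesis"
      \<comment> \<open>Pigeonhole along the chain: if \<open>F\<close> met the classes of all
        \<open>1 + r (k n)\<close>, two of them would agree modulo \<open>r (s \<rho>)\<close>. Then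
        \<open>r (k n)\<close> would divide \<open>r (k m)\<close> with \<open>m < n\<close>,
        against strictness.\<close>
      obtain k :: "nat \<Rightarrow> 'a" where k: "\<And>n. (s \<sigma>, k n) \<in> W \<and> (k n, s \<rho>) \<in> W"
        "\<And>m n. m < n \<Longrightarrow> (k m, k n) \<in> W \<and> k m \<noteq> k n"
        using s_gap[OF \<sigma>\<rho>] unfolding infinite_gap_def by blast
      have dk: "r' \<sigma> dvd r (k n)" for n
        using k(1) mono unfolding r'_def by blast
      have "1 + r (k n) dvd 1" for n
        by (rule valuation_domain_unit_add[OF assms(1) _ r'_nonunit[OF FW(1)[OF \<sigma>\<rho>(1)]]]) (use dk in auto)
      moreover have "d dvd r (k n)" for n
        using d_dvd[OF FW(1)[OF \<sigma>\<rho>(1)]] dk dvd_trans by blast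
      ultimately have "1 + r (k n) \<in> V" for n
        by (simp add: V_def)
      moreover have "E \<sigma> (1 + r (k n)) 1" for n
        using dk by (simp add: E_def)
      ultimately have "\<forall>n. \<exists>u\<in>F. E \<rho> (1 + r (k n)) u"
        using contr by blast
      then obtain h where h: "\<And>n. h n \<in> F \<and> E \<rho> (1 + r (k n)) (h n)"
        by metis
      then have "finite (range h)"
        using F finite_subset[of "range h" F] by blast
      then have "\<not> inj h"
        using finite_imageD infinite_UNIV_nat by blast
      then obtain m n where mn: "m < n" "h m = h n"
        unfolding inj_def by (metis linorder_neqE_nat)
      have hE: "r' \<rho> dvd 1 + r (k n) - h n" for n
        using h[of n] by (simp add: E_def)
      have "r' \<rho> dvd (1 + r (k m) - h m) - (1 + r (k n) - h n)"
        by (rule dvd_diff[OF hE hE])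
      then have "r (s \<rho>) dvd r (k m) - r (k n)"
        using mn(2) by (simp add: r'_def)
      then have "r (k n) dvd r (k m) - r (k n)"
        using k(1)[of n] mono dvd_trans by blast
      then have "r (k n) dvd r (k m)"
        using dvd_add[of "r (k n)" "r (k m) - r (k n)" "r (k n)"] by simp
      then show False
        using k(2)[OF mn(1)] strict by blast
    qed
  qed
  obtain e and f :: "'a \<Rightarrow> 'a \<Rightarrow> rat" where eV: "\<And>\<sigma> \<rho>. (\<sigma>, \<rho>) \<in> W \<Longrightarrow> e \<rho> \<sigma> \<in> V"
    and e_coh: "\<And>\<sigma> \<tau> \<rho>. (\<sigma>, \<tau>) \<in> W \<Longrightarrow> (\<tau>, \<rho>) \<in> W \<Longrightarrow> E \<sigma> (e \<rho> \<sigma>) (e \<rho> \<tau> * e \<tau> \<sigma>)"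
    and f_cong: "\<And>\<sigma> x y. \<sigma> \<in> Field W \<Longrightarrow> E \<sigma> x y \<Longrightarrow> f \<sigma> x = f \<sigma> y"
    and f_less: "\<And>\<sigma> \<rho> x. (\<sigma>, \<rho>) \<in> W \<Longrightarrow> \<sigma> \<noteq> \<rho> \<Longrightarrow> x \<in> V \<Longrightarrow> f \<sigma> (x * e \<rho> \<sigma>) < f \<rho> x"
    by (rule special_functions_exist) (rule that)
  have e_unit: "e \<rho> \<sigma> dvd 1" if "(\<sigma>, \<rho>) \<in> W" for \<sigma> \<rho>
    using eV[OF that] by (simp add: V_def)
  \<comment> \<open>The quotient of \<open>r' \<rho>\<close> by \<open>r' \<sigma>\<close>. It is
    multiplicative along the order, so coherence of \<open>e\<close> modulo
    \<open>r' \<sigma>\<close> becomes, after multiplication by \<open>q \<rho> \<sigma>\<close>,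
    the cocycle condition for \<open>c\<close> modulo \<open>r' \<rho>\<close>.\<close>
  define q where "q \<rho> \<sigma> = (SOME q. r' \<rho> = r' \<sigma> * q)" for \<rho> \<sigma>
  have q: "r' \<rho> = r' \<sigma> * q \<rho> \<sigma>" if "(\<sigma>, \<rho>) \<in> W" for \<sigma> \<rho>
    unfolding q_def by (rule someI_ex) (use r'_mono[OF that] in \<open>auto simp: dvd_def\<close>)
  define c where "c \<rho> \<sigma> = q \<rho> \<sigma> * e \<rho> \<sigma>" for \<rho> \<sigma>
  have q0: "q \<rho> \<sigma> \<noteq> 0" if "(\<sigma>, \<rho>) \<in> W" for \<sigma> \<rho>
    using q[OF that] r'0[OF FW(2)[OF that]] by auto
  have "infinite (UNIV :: 'a set)"
  proof -
    have "infinite (Field W)"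
    proof
      assume "finite (Field W)"
      then obtain \<mu> where "\<mu> \<in> Field W" "\<forall>a\<in>Field W. (a, \<mu>) \<in> W \<and> a \<noteq> \<mu>"
        using omega1_bounded[OF \<omega>, of "Field W"] by (auto simp: countable_finite)
      then show False by blast
    qed
    then show ?thesis using infinite_super subset_UNIV by blast
  qed
  then obtain cls :: "'a \<Rightarrow> 'a \<Rightarrow> 'a set" where cls: "direct_limit W r' c cls"
  proof (rule direct_limit_exists)
    show "(\<sigma>, \<sigma>) \<in> W" if "\<sigma> \<in> Field W" for \<sigma>
      using that by (rule W_refl)
    show "(\<sigma>, \<rho>) \<in> W" if "(\<sigma>, \<tau>) \<in> W" "(\<tau>, \<rho>) \<in> W" for \<sigma> \<tau> \<rho>
      using W_trans that .
    show "\<exists>\<rho>. (\<sigma>, \<rho>) \<in> W \<and> (\<tau>, \<rho>) \<in> W" if "\<sigma> \<in> Field W" "\<tau> \<in> Field W" for \<sigma> \<tau>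
      using that W_total W_refl by blast
    show "Field W \<noteq> {}" using \<gamma> by blast
    show "r' \<rho> dvd c \<rho> \<sigma> - c \<rho> \<tau> * c \<tau> \<sigma>" if st: "(\<sigma>, \<tau>) \<in> W" "(\<tau>, \<rho>) \<in> W" for \<sigma> \<tau> \<rho>
    proof -
      have sr: "(\<sigma>, \<rho>) \<in> W" using W_trans st .
      have "r' \<sigma> * q \<rho> \<sigma> = r' \<sigma> * (q \<rho> \<tau> * q \<tau> \<sigma>)"
        using q[OF sr] q[OF st(1)] q[OF st(2)] by (metis mult.assoc mult.commute)
      then have "q \<rho> \<sigma> = q \<rho> \<tau> * q \<tau> \<sigma>"
        using r'0[OF FW(1)[OF sr]] by simp
      then have "c \<rho> \<sigma> - c \<rho> \<tau> * c \<tau> \<sigma> = (e \<rho> \<sigma> - e \<rho> \<tau> * e \<tau> \<sigma>) * q \<rho> \<sigma>"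
        by (simp add: c_def algebra_simps)
      then show ?thesis
        using e_coh[OF st] unfolding q[OF sr] E_def by (simp add: mult_dvd_mono)
    qed
    show "r' \<rho> dvd c \<rho> \<sigma> * x \<longleftrightarrow> r' \<sigma> dvd x" if sr: "(\<sigma>, \<rho>) \<in> W" for \<sigma> \<rho> x
    proof -
      obtain t where t: "1 = e \<rho> \<sigma> * t"
        using e_unit[OF sr] by (rule dvdE)
      have "r' \<rho> dvd c \<rho> \<sigma> * x \<longleftrightarrow> q \<rho> \<sigma> * r' \<sigma> dvd q \<rho> \<sigma> * (e \<rho> \<sigma> * x)"
        unfolding q[OF sr] c_def by (simp only: mult_ac)
      also have "\<dots> \<longleftrightarrow> r' \<sigma> dvd e \<rho> \<sigma> * x"
        using q0[OF sr] by simp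
      also have "\<dots> \<longleftrightarrow> r' \<sigma> dvd x"
      proof
        assume "r' \<sigma> dvd e \<rho> \<sigma> * x"
        then have "r' \<sigma> dvd t * (e \<rho> \<sigma> * x)" by (rule dvd_mult)
        moreover have "t * (e \<rho> \<sigma> * x) = x"
          using t by (metis mult.assoc mult.commute mult_1_left)
        ultimately show "r' \<sigma> dvd x" by simp
      qed simp
      finally show ?thesis .
    qed
  qed
  interpret twisted_limit W r' c cls e
  proof (intro twisted_limit.intro twisted_limit_axioms.intro)
    show "direct_limit W r' c cls" by (rule cls)
    show "c \<rho> \<sigma> * r' \<sigma> = r' \<rho> * e \<rho> \<sigma>" if "(\<sigma>, \<rho>) \<in> W" for \<sigma> \<rho>
      unfolding q[OF that] c_def by (simp only: mult_ac)
  qed (use assms(1) r'0 r'_nonunit e_unit in auto)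
  text \<open>Only the units congruent to 1 modulo \<open>r \<gamma>\<close> carry a special function so far. Multiplying by
    the inverse of a representative chosen modulo \<open>r \<gamma>\<close> transfers it to all units, because the
    transition units \<open>e\<close> do not change this class.\<close>
  define rep where "rep u = (SOME u'. u' dvd 1 \<and> d dvd u - u')" for u
  define i where "i u = (SOME w. rep u * w = 1)" for u
  define F where "F \<sigma> u = f \<sigma> (u * i u)" for \<sigma> u
  have rep: "rep u dvd 1 \<and> d dvd u - rep u" if "u dvd 1" for u
    unfolding rep_def by (rule someI[of _ u]) (use that in simp)
  have i: "rep u * i u = 1" if "u dvd 1" for u
    unfolding i_def by (rule someI_ex) (use rep[OF that] in \<open>metis dvd_def\<close>)
  have i_cong: "i u = i v" if uv: "d dvd u - v" for u v
  proof -
    \<comment> \<open>The choices in \<open>rep\<close> and \<open>i\<close> see \<open>u\<close>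
      only through this predicate, so units congruent modulo \<open>d\<close> receive literally the
      same \<open>i\<close>.\<close>
    have "d dvd u - z \<longleftrightarrow> d dvd v - z" for z
      using dvd_add[of d "u - v" "v - z"] dvd_diff[of d "u - z" "u - v"] uv by auto
    then show ?thesis by (simp add: i_def rep_def)
  qed
  have iV: "u * i u \<in> V" if u: "u dvd 1" for u
  proof -
    have "u * i u - 1 = (u - rep u) * i u"
      using i[OF u] by (simp add: left_diff_distrib)
    moreover have "i u dvd 1"
      using i[OF u] by (metis dvd_triv_right)
    ultimately show ?thesis
      using u rep[OF u] mult_dvd_mono[of u 1 "i u" 1] by (simp add: V_def)
  qed
  have F_cong: "F \<sigma> u = F \<sigma> v" if "\<sigma> \<in> Field W" "r' \<sigma> dvd u - v" for \<sigma> u v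
  proof -
    have iuv: "i u = i v"
      using i_cong d_dvd[OF that(1)] that(2) dvd_trans by blast
    have "E \<sigma> (u * i v) (v * i v)"
      using that(2) unfolding E_def left_diff_distrib[symmetric] by (rule dvd_mult2)
    then show ?thesis
      unfolding F_def iuv by (rule f_cong[OF that(1)])
  qed
  have F_less: "F \<sigma> (e \<rho> \<sigma> * v) < F \<rho> v" if W: "(\<sigma>, \<rho>) \<in> W" "\<sigma> \<noteq> \<rho>" and v: "v dvd 1" for \<sigma> \<rho> v
  proof -
    have "e \<rho> \<sigma> * v - v = (e \<rho> \<sigma> - 1) * v" by (simp add: algebra_simps)
    then have "d dvd e \<rho> \<sigma> * v - v"
      using eV[OF W(1)] by (simp add: V_def)
    then have iev: "i (e \<rho> \<sigma> * v) = i v" by (rule i_cong)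
    have "f \<sigma> (v * i v * e \<rho> \<sigma>) < f \<rho> (v * i v)"
      using f_less[OF W iV[OF v]] .
    then show ?thesis unfolding F_def iev by (simp only: mult_ac)
  qed
  \<comment> \<open>An isomorphism is read off from the image of the generator. The unit is
    determined only modulo \<open>r' \<sigma>\<close>, which \<open>F_cong\<close> makes
    harmless.\<close>
  define g where "g \<sigma> \<psi> = F \<sigma> (SOME u. u dvd 1 \<and> \<psi> (cls \<sigma> 1) = coset_R (Fract u (r' \<sigma>)))" for \<sigma> \<psi>
  have "explicitly_nonstandard U J"
    unfolding explicitly_nonstandard_def
  proof (intro exI conjI)
    show "type_repr W r' J" by (rule repr')
    show "\<forall>\<sigma>\<in>Field W. cls \<sigma> 1 \<in> carrier U \<and> Ann U (cls \<sigma> 1) = pideal (r' \<sigma>)"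
      by (simp add: cls_carrier Ann_cls)
    show "\<forall>\<sigma> \<rho> \<psi> \<phi>. (\<sigma>, \<rho>) \<in> W \<and> \<sigma> \<noteq> \<rho> \<and> \<psi> \<in> Isos U (cls \<sigma> 1) (r' \<sigma>) \<and> \<phi> \<in> Isos U (cls \<rho> 1) (r' \<rho>) \<and>
        (\<forall>u\<in>cyc U (cls \<sigma> 1). \<phi> u = \<psi> u) \<longrightarrow> g \<sigma> \<psi> < g \<rho> \<phi>"
    proof (intro allI impI, elim conjE)
      fix \<sigma> \<rho> \<psi> \<phi>
      assume W: "(\<sigma>, \<rho>) \<in> W" "\<sigma> \<noteq> \<rho>" and \<psi>: "\<psi> \<in> Isos U (cls \<sigma> 1) (r' \<sigma>)"
        and \<phi>: "\<phi> \<in> Isos U (cls \<rho> 1) (r' \<rho>)" and ext: "\<forall>u\<in>cyc U (cls \<sigma> 1). \<phi> u = \<psi> u"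
      define u where "u = (SOME u. u dvd 1 \<and> \<psi> (cls \<sigma> 1) = coset_R (Fract u (r' \<sigma>)))"
      define v where "v = (SOME u. u dvd 1 \<and> \<phi> (cls \<rho> 1) = coset_R (Fract u (r' \<rho>)))"
      have u: "u dvd 1 \<and> \<psi> (cls \<sigma> 1) = coset_R (Fract u (r' \<sigma>))"
        unfolding u_def by (rule someI_ex[OF Isos_obtain_unit[OF FW(1)[OF W(1)] \<psi>]])
      have v: "v dvd 1 \<and> \<phi> (cls \<rho> 1) = coset_R (Fract v (r' \<rho>))"
        unfolding v_def by (rule someI_ex[OF Isos_obtain_unit[OF FW(2)[OF W(1)] \<phi>]])
      have "\<phi> (cls \<sigma> 1) = coset_R (Fract u (r' \<sigma>))"
        using ext u unfolding cyc_cls[OF FW(1)[OF W(1)]] by simp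
      then have "r' \<sigma> dvd e \<rho> \<sigma> * v - u"
        using Isos_extend_unit[OF W(1) \<phi>] v by blast
      then have "F \<sigma> u = F \<sigma> (e \<rho> \<sigma> * v)"
        using F_cong[OF FW(1)[OF W(1)]] by metis
      also have "\<dots> < F \<rho> v"
        using F_less[OF W] v by blast
      finally show "g \<sigma> \<psi> < g \<rho> \<phi>"
        by (simp add: g_def u_def v_def)
    qed
  qed
  moreover have "has_type U J Rq"
    using has_type_U repr' unfolding type_repr_def by metis
  moreover have "uniserial U"
    using uniserial_U valuation_domain_dvd_total[OF assms(1)] by blast
  ultimately show ?thesis by blast
qed

end
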